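(* If there is an RDSQS$^{\ast}(v)$, then there is an RDSQS$(4v)$.
   Context: A Steiner quadruple system SQS$(v)$ is a pair $(X,\mathcal{B})$ where $X$ is a set of $v$ points and $\mathcal{B}$ is a collection of $4$-element subsets of $X$ (blocks) such that every $3$-element subset of $X$ is contained in exactly one block. For $x\in X$, put $\mathcal{B}_x=\{B\setminus\{x\}: x\in B,\ B\in\mathcal{B}\}$; the pair $(X\setminus\{x\},\mathcal{B}_x)$ is called the derived design at $x$ and is a Steiner triple system on $v-1$ points. A parallel class on a set $Y$ is a set of blocks that partitions $Y$; a design on $Y$ is resolvable if its block set can be partitioned into parallel classes on $Y$. An RDSQS$(v)$ is an SQS$(v)$ whose derived design at every point is resolvable. Let $v\equiv 1 \pmod 3$. An RDSQS$^{\ast}(v)$ is an SQS$(v)$ $(X,\mathcal{B})$ with the following properties for every $x\in X$: (1) there is a parallel class $P'_x=\{B_{x,k}: 1\le k\le \frac{v-1}{3}\}\subseteq \mathcal{B}_x$ of $X\setminus\{x\}$; (2) the multiset $\mathcal{M}$ containing each triple of $P'_x$ three times and each triple of $\mathcal{B}_x\setminus P'_x$ twice can be partitioned into $v-1$ parallel classes $P_{x,k}^{l}$ of $X\setminus\{x\}$, $1\le k\le\frac{v-1}{3}$, $1\le l\le 3$; (3) for each $1\le k\le \frac{v-1}{3}$, the three parallel classes $P_{x,k}^{1},P_{x,k}^{2},P_{x,k}^{3}$ all contain the triple $B_{x,k}$. *)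

theory Defs
  imports Main "HOL-Library.Disjoint_Sets" "HOL-Library.Multiset"
begin

definition SQS :: "nat \<Rightarrow> 'a set \<Rightarrow> 'a set set \<Rightarrow> bool" where
  "SQS v X \<B> \<longleftrightarrow>
     finite X \<and> card X = v \<and>
     (\<forall>B\<in>\<B>. B \<subseteq> X \<and> card B = 4) \<and>
     (\<forall>T. T \<subseteq> X \<and> card T = 3 \<longrightarrow> (\<exists>!B. B \<in> \<B> \<and> T \<subseteq> B))"

definition derived_blocks :: "'a set set \<Rightarrow> 'a \<Rightarrow> 'a set set" where
  "derived_blocks \<B> x = {B - {x} | B. x \<in> B \<and> B \<in> \<B>}"

definition parallel_class :: "'a set \<Rightarrow> 'a set set \<Rightarrow> 'a set set \<Rightarrow> bool" where
  "parallel_class Y \<C> P \<longleftrightarrow> P \<subseteq> \<C> \<and> partition_on Y P"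

definition resolvable :: "'a set \<Rightarrow> 'a set set \<Rightarrow> bool" where
  "resolvable Y \<C> \<longleftrightarrow> (\<exists>R. partition_on \<C> R \<and> (\<forall>P\<in>R. parallel_class Y \<C> P))"

definition RDSQS :: "nat \<Rightarrow> 'a set \<Rightarrow> 'a set set \<Rightarrow> bool" where
  "RDSQS v X \<B> \<longleftrightarrow>
     SQS v X \<B> \<and> (\<forall>x\<in>X. resolvable (X - {x}) (derived_blocks \<B> x))"

text \<open>
  In the following definition \<open>b k\<close> is the triple written $B_{x,k}$ and \<open>P k l\<close> is the
  parallel class written $P_{x,k}^l$. The family \<open>P\<close> is indexed and need not be injective,
  since a partition of a multiset may use the same parallel class more than once.
\<close>

definition RDSQS_star :: "nat \<Rightarrow> 'a set \<Rightarrow> 'a set set \<Rightarrow> bool" where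
  "RDSQS_star v X \<B> \<longleftrightarrow>
     v mod 3 = 1 \<and> SQS v X \<B> \<and>
     (\<forall>x\<in>X. \<exists>P' b P.
        parallel_class (X - {x}) (derived_blocks \<B> x) P' \<and>
        bij_betw b {1..(v - 1) div 3} P' \<and>
        (\<forall>k\<in>{1..(v - 1) div 3}. \<forall>l\<in>{1..3::nat}.
           parallel_class (X - {x}) (derived_blocks \<B> x) (P k l)) \<and>
        (\<Sum>k\<in>{1..(v - 1) div 3}. \<Sum>l\<in>{1..3::nat}. mset_set (P k l)) =
          repeat_mset 3 (mset_set P') + repeat_mset 2 (mset_set (derived_blocks \<B> x - P')) \<and>
        (\<forall>k\<in>{1..(v - 1) div 3}. \<forall>l\<in>{1..3::nat}. b k \<in> P k l))"

end

theory Submission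
  imports Defs
begin

text \<open>
  The quadrupled system lives on \<open>X \<times> F\<close>, where \<open>F\<close> is the field with four elements. Four points
  form a block when their second coordinates sum to zero and their first coordinates either form a
  block or fall into two pairs of equal elements. That this is again a quadruple system is clear
  once a quadruple system is seen as a ternary operation: three elements, not necessarily distinct,
  determine a fourth, where \<open>x, x, y\<close> determines \<open>y\<close> (\<open>SQS_skein\<close>, \<open>skein_SQS\<close>). Such
  operations are closed under direct products (\<open>skein_prod\<close>), and addition of three elements of
  \<open>F\<close> is one of them.

  The work is to resolve the derived design at a point \<open>(x, i)\<close>. By \<open>derived_prod\<close> it has three
  kinds of triples: the apex \<open>{x} \<times> (F - {i})\<close>, the vertical triples
  \<open>{(x, j), (y, a), (y, a + i + j)}\<close>, and the graphs of the functions \<open>T \<rightarrow> F\<close> with sum \<open>i\<close>,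
  where \<open>T\<close> is a triple of the old derived design at \<open>x\<close>. Label the three points of \<open>T\<close> by the
  nonzero elements of \<open>F\<close>. The functions with sum \<open>i\<close> are then exactly
  \<open>u \<mapsto> i + \<alpha> u + \<beta> u\<^sup>2\<close>, and for a fixed \<open>\<beta>\<close> the four graphs are disjoint, so they partition
  \<open>T \<times> F\<close>. Thus \<open>T\<close> comes with four partial parallel classes, one for each \<open>\<beta>\<close>.

  Every class of the given family is used twice, which produces one slot per copy. A triple \<open>T\<close>
  outside the distinguished parallel class \<open>P'\<close> lies in two classes, hence in four slots, and
  these receive the four values of \<open>\<beta>\<close>. A triple of \<open>P'\<close> lies in three classes, hence in six
  slots, which are exactly those attached to it; they receive the six two-element subsets \<open>A\<close> of
  \<open>F\<close>. Over this triple, put \<open>\<beta> = \<Sum>A\<close>, keep the graphs with \<open>\<alpha> \<in> A\<close> and cut what remains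
  vertically: over a point with label \<open>u\<close> two elements are left, and they differ by \<open>\<beta> u\<close>, so the
  vertical triple through them contains \<open>(x, i + \<beta> u)\<close>. As \<open>u\<close> runs through the three labels, so
  does \<open>\<beta> u\<close>, and these three vertical triples cover every remaining point above \<open>x\<close>. The graphs
  with \<open>\<beta> = 0\<close> over the triples of \<open>P'\<close> remain; with the apex they form the last class.
  Above the block that \<open>x\<close> forms with a triple of \<open>P'\<close>, the fifteen points other than \<open>(x, i)\<close> and
  the derived triples within them form the projective space of dimension three over the field with two
  elements, and the seven classes split its lines into spreads.
  The construction is the definition \<open>slot_class\<close>; \<open>partition_None\<close>, \<open>partition_Some\<close> and
  \<open>star_resolvable\<close> verify it.
\<close>

section \<open>The field with four elements\<close>

datatype gf4 = G0 | G1 | Gw | Gw1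

instantiation gf4 :: field
begin

definition zero_gf4 :: gf4 where "0 = G0"
definition one_gf4 :: gf4 where "1 = G1"

fun plus_gf4 :: "gf4 \<Rightarrow> gf4 \<Rightarrow> gf4" where
  "G0 + b = b"
| "a + G0 = a"
| "G1 + G1 = G0" | "G1 + Gw = Gw1" | "G1 + Gw1 = Gw"
| "Gw + G1 = Gw1" | "Gw + Gw = G0" | "Gw + Gw1 = G1"
| "Gw1 + G1 = Gw" | "Gw1 + Gw = G1" | "Gw1 + Gw1 = G0"

fun times_gf4 :: "gf4 \<Rightarrow> gf4 \<Rightarrow> gf4" where
  "G0 * b = G0"
| "a * G0 = G0"
| "G1 * b = b"
| "a * G1 = a"
| "Gw * Gw = Gw1" | "Gw * Gw1 = G1" | "Gw1 * Gw = G1" | "Gw1 * Gw1 = Gw"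

definition uminus_gf4 :: "gf4 \<Rightarrow> gf4" where "- (a :: gf4) = a"
definition minus_gf4 :: "gf4 \<Rightarrow> gf4 \<Rightarrow> gf4" where "(a :: gf4) - b = a + b"

fun inverse_gf4 :: "gf4 \<Rightarrow> gf4" where
  "inverse G0 = G0" | "inverse G1 = G1" | "inverse Gw = Gw1" | "inverse Gw1 = Gw"

definition divide_gf4 :: "gf4 \<Rightarrow> gf4 \<Rightarrow> gf4" where "(a :: gf4) div b = a * inverse b"

instance
proof
  fix a b c :: gf4
  show "a + b + c = a + (b + c)" by (cases a; cases b; cases c; simp)
  show "a + b = b + a" by (cases a; cases b; simp)
  show "0 + a = a" by (simp add: zero_gf4_def)
  show "- a + a = 0" by (cases a; simp add: zero_gf4_def uminus_gf4_def)
  show "a - b = a + - b" by (simp add: minus_gf4_def uminus_gf4_def)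
  show "a * b * c = a * (b * c)" by (cases a; cases b; cases c; simp)
  show "a * b = b * a" by (cases a; cases b; simp)
  show "1 * a = a" by (cases a; simp add: one_gf4_def)
  show "(a + b) * c = a * c + b * c" by (cases a; cases b; cases c; simp)
  show "(0::gf4) \<noteq> 1" by (simp add: zero_gf4_def one_gf4_def)
  show "a \<noteq> 0 \<Longrightarrow> inverse a * a = 1" by (cases a; simp add: zero_gf4_def one_gf4_def)
  show "a div b = a * inverse b" by (rule divide_gf4_def)
  show "inverse (0::gf4) = 0" by (simp add: zero_gf4_def)
qed

end

lemma UNIV_gf4: "UNIV = {G0, G1, Gw, Gw1}"
  by (auto intro: gf4.exhaust)

instance gf4 :: finite
  by standard (simp add: UNIV_gf4)

lemma card_gf4: "card (UNIV :: gf4 set) = 4"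
  by (simp add: UNIV_gf4)

lemma gf4_add_self: "a + a = (0 :: gf4)"
  by (cases a; simp add: zero_gf4_def)

lemma gf4_eq_iff_add: "a = b \<longleftrightarrow> a + b = (0 :: gf4)"
  by (metis gf4_add_self add_left_cancel)

text \<open>Through each point of \<open>T \<times> F\<close> there is exactly one graph with a given \<open>\<beta>\<close>, because the
  coefficient of \<open>\<alpha>\<close> is a label and hence nonzero.\<close>
lemma gf4_solve:
  assumes "m \<noteq> (0 :: gf4)"
  shows "a = i + \<alpha> * m + \<beta> * m\<^sup>2 \<longleftrightarrow> \<alpha> = (a + i + \<beta> * m\<^sup>2) / m"
proof -
  have "a = i + \<alpha> * m + \<beta> * m\<^sup>2 \<longleftrightarrow> a + (i + \<alpha> * m + \<beta> * m\<^sup>2) = 0" by (rule gf4_eq_iff_add)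
  also have "\<dots> \<longleftrightarrow> \<alpha> * m + (a + i + \<beta> * m\<^sup>2) = 0" by (simp add: ac_simps)
  also have "\<dots> \<longleftrightarrow> \<alpha> * m = a + i + \<beta> * m\<^sup>2" by (rule gf4_eq_iff_add[symmetric])
  also have "\<dots> \<longleftrightarrow> \<alpha> = (a + i + \<beta> * m\<^sup>2) / m" using assms by (simp add: nonzero_eq_divide_eq)
  finally show ?thesis .
qed

lemma nonzero_gf4: "- {0} = {G1, Gw, Gw1}"
  using UNIV_gf4 by (auto simp: zero_gf4_def)

lemma gf4_add_move: "a + b = c \<longleftrightarrow> a = b + (c :: gf4)"
  by (simp only: gf4_eq_iff_add[of "a + b" c] gf4_eq_iff_add[of a "b + c"] add.assoc)

lemma gf4_add_cancel: "a + (a + b) = (b :: gf4)"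
  by (simp add: add.assoc[symmetric] gf4_add_self)

text \<open>A two-element subset is a coset of the subgroup generated by its sum. The subsets with a given sum
  \<open>\<beta>\<close> are therefore the two cosets of \<open>{0, \<beta>}\<close>, and a graph with parameters \<open>\<alpha>\<close> and
  \<open>\<beta> \<noteq> 0\<close> selects one of them.\<close>
lemma pair_gf4:
  assumes "card A = 2"
  shows "\<alpha> \<in> A \<and> \<Sum>A = \<beta> \<longleftrightarrow> A = {\<alpha>, \<alpha> + \<beta> :: gf4}"
proof
  assume *: "\<alpha> \<in> A \<and> \<Sum>A = \<beta>"
  obtain a b where A: "A = {a, b}" "a \<noteq> b" using assms by (auto simp: card_2_iff)
  then have "\<beta> = a + b" using * by simp
  moreover have "\<alpha> = a \<or> \<alpha> = b" using * A by simp
  ultimately show "A = {\<alpha>, \<alpha> + \<beta>}"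
    using A gf4_add_cancel[of a b] gf4_add_cancel[of b a] by (auto simp: add.commute)
next
  assume *: "A = {\<alpha>, \<alpha> + \<beta>}"
  then have "\<alpha> \<noteq> \<alpha> + \<beta>" using assms by auto
  then have "\<Sum>A = \<alpha> + (\<alpha> + \<beta>)" unfolding * by (subst sum.insert) auto
  then show "\<alpha> \<in> A \<and> \<Sum>A = \<beta>" using * gf4_add_cancel by simp
qed

lemma pair_sum_nonzero: "card A = 2 \<Longrightarrow> \<Sum>A \<noteq> (0 :: gf4)"
  by (auto simp: card_2_iff gf4_eq_iff_add[symmetric])

lemma card_pair: "\<beta> \<noteq> 0 \<Longrightarrow> card {\<alpha>, \<alpha> + \<beta> :: gf4} = 2"
  by (auto simp: card_2_iff)

lemma compl_pair:
  assumes "card (A :: gf4 set) = 2"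
  shows "card (- A) = 2" "\<Sum>(- A) = \<Sum>A"
proof -
  show "card (- A) = 2" using assms by (simp add: Compl_eq_Diff_UNIV card_Diff_subset card_gf4)
  have "\<Sum>A + \<Sum>(- A) = \<Sum>(A \<union> - A)" by (rule sum.union_disjoint[symmetric]) auto
  also have "\<dots> = 0" by (simp add: UNIV_gf4 zero_gf4_def)
  finally have "\<Sum>A = \<Sum>(- A)" by (rule iffD2[OF gf4_eq_iff_add])
  then show "\<Sum>(- A) = \<Sum>A" by (rule sym)
qed

lemma card_pairs_gf4: "card {A :: gf4 set. card A = 2} = 6"
  using n_subsets[of "UNIV :: gf4 set" 2] by (simp add: card_gf4 choose_two)

lemma sum_nonzero_gf4: "(\<Sum>u\<in>- {0}. f u) = f G1 + (f Gw + f Gw1)"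
  unfolding nonzero_gf4 by simp

text \<open>The nonzero elements are the cube roots of unity, so their first and second power sums vanish;
  the constant term survives because three is odd.\<close>
lemma sum_quadratic_gf4: "(\<Sum>u\<in>- {0}. i + \<alpha> * u + \<beta> * u\<^sup>2) = (i :: gf4)"
  unfolding sum_nonzero_gf4 power2_eq_square
  by (cases i; cases \<alpha>; cases \<beta>; simp only: plus_gf4.simps times_gf4.simps)

text \<open>The coefficients are given by the discrete Fourier transform on the group of cube roots of unity;
  the constant coefficient is the sum of the values since dividing by three changes nothing in
  characteristic two.\<close>
lemma interpolate_gf4:
  "\<exists>\<alpha> \<beta>. \<forall>u\<in>- {0}. g u = (\<Sum>u\<in>- {0}. g u) + \<alpha> * u + \<beta> * (u :: gf4)\<^sup>2"
proof (intro exI)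
  show "\<forall>u\<in>- {0}. g u = (\<Sum>u\<in>- {0}. g u) + (g G1 + Gw1 * g Gw + Gw * g Gw1) * u
      + (g G1 + Gw * g Gw + Gw1 * g Gw1) * u\<^sup>2"
    unfolding sum_nonzero_gf4 power2_eq_square unfolding nonzero_gf4
    by (cases "g G1"; cases "g Gw"; cases "g Gw1"; simp)
qed

lemma quadratic_unique_gf4:
  assumes "\<And>u. u \<noteq> 0 \<Longrightarrow> i + \<alpha> * u + \<beta> * u\<^sup>2 = i + \<alpha>' * u + \<beta>' * (u :: gf4)\<^sup>2"
  shows "\<alpha> = \<alpha>' \<and> \<beta> = \<beta>'"
proof -
  have eq: "\<alpha> * u + \<beta> * (u * u) = \<alpha>' * u + \<beta>' * (u * u)" if "u \<noteq> 0" for u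
    using assms[OF that] by (simp add: add.assoc power2_eq_square)
  have "G1 \<noteq> 0" "Gw \<noteq> 0" by (simp_all add: zero_gf4_def)
  from eq[OF this(1)] eq[OF this(2)] show ?thesis
    by (cases \<alpha>; cases \<beta>; cases \<alpha>'; cases \<beta>';
      simp only: plus_gf4.simps times_gf4.simps gf4.distinct zero_gf4_def simp_thms)
qed

section \<open>Quadruple systems as ternary operations\<close>

text \<open>The graph of the ternary operation that sends \<open>x, y, z\<close> to the fourth point of their block and
  satisfies \<open>x, x, y \<mapsto> y\<close> (an SQS-skein). A transposition and a 4-cycle generate
  all permutations of the arguments.\<close>
definition skein :: "'a set \<Rightarrow> ('a \<Rightarrow> 'a \<Rightarrow> 'a \<Rightarrow> 'a \<Rightarrow> bool) \<Rightarrow> bool" where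
  "skein X Q \<longleftrightarrow>
     (\<forall>x y z w. Q x y z w \<longrightarrow> {x, y, z, w} \<subseteq> X \<and> Q y x z w \<and> Q y z w x) \<and>
     (\<forall>x\<in>X. \<forall>y\<in>X. \<forall>z\<in>X. \<exists>!w. Q x y z w) \<and>
     (\<forall>x\<in>X. \<forall>y\<in>X. Q x x y y)"

definition quads :: "('a \<Rightarrow> 'a \<Rightarrow> 'a \<Rightarrow> 'a \<Rightarrow> bool) \<Rightarrow> 'a set set" where
  "quads Q = {{x, y, z, w} | x y z w. distinct [x, y, z, w] \<and> Q x y z w}"

lemma skeinI:
  assumes "\<And>x y z w. Q x y z w \<Longrightarrow> {x, y, z, w} \<subseteq> X"
    and "\<And>x y z w. Q x y z w \<Longrightarrow> Q y x z w"
    and "\<And>x y z w. Q x y z w \<Longrightarrow> Q y z w x"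
    and "\<And>x y z. x \<in> X \<Longrightarrow> y \<in> X \<Longrightarrow> z \<in> X \<Longrightarrow> \<exists>!w. Q x y z w"
    and "\<And>x y. x \<in> X \<Longrightarrow> y \<in> X \<Longrightarrow> Q x x y y"
  shows "skein X Q"
  unfolding skein_def by (intro conjI allI impI ballI) (rule assms; assumption)+

lemma skein_in: "skein X Q \<Longrightarrow> Q x y z w \<Longrightarrow> x \<in> X \<and> y \<in> X \<and> z \<in> X \<and> w \<in> X"
  unfolding skein_def by blast

lemma skein_swap: "skein X Q \<Longrightarrow> Q x y z w \<Longrightarrow> Q y x z w"
  unfolding skein_def by blast

lemma skein_rot: "skein X Q \<Longrightarrow> Q x y z w \<Longrightarrow> Q y z w x"
  unfolding skein_def by blast

lemma skein_unique: "skein X Q \<Longrightarrow> Q x y z w \<Longrightarrow> Q x y z w' \<Longrightarrow> w = w'"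
  unfolding skein_def by blast

lemma skein_ex: "skein X Q \<Longrightarrow> x \<in> X \<Longrightarrow> y \<in> X \<Longrightarrow> z \<in> X \<Longrightarrow> \<exists>w. Q x y z w"
  unfolding skein_def by blast

lemma skein_pair: "skein X Q \<Longrightarrow> x \<in> X \<Longrightarrow> y \<in> X \<Longrightarrow> Q x x y y"
  unfolding skein_def by blast

lemma skein_eq: "skein X Q \<Longrightarrow> Q x x z w \<Longrightarrow> z = w"
  by (meson skein_in skein_pair skein_unique)

lemma quads_complete:
  assumes Q: "skein X Q" and U: "U \<in> quads Q"
    and pqr: "p \<in> U" "q \<in> U" "r \<in> U" "p \<noteq> q" "p \<noteq> r" "q \<noteq> r"
  shows "\<exists>s. U = {p, q, r, s} \<and> distinct [p, q, r, s] \<and> Q p q r s"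
proof -
  obtain a b c d where U': "U = {a, b, c, d}" "distinct [a, b, c, d]" "Q a b c d"
    using U unfolding quads_def by blast
  note s = skein_swap[OF Q] and r = skein_rot[OF Q]
  have perm: "Q x z y w" "Q x y w z" "Q y x z w" if "Q x y z w" for x y z w
    using r[OF r[OF r[OF s[OF r[OF that]]]]] r[OF r[OF s[OF r[OF r[OF that]]]]] s[OF that] .
  have "\<exists>b c d. U = {p, b, c, d} \<and> distinct [p, b, c, d] \<and> Q p b c d"
  proof -
    consider "p = a" | "p = b" | "p = c" | "p = d" using pqr U' by blast
    then show ?thesis
    proof cases
      case 1 with U' show ?thesis by blast
    next
      case 2
      have "U = {p, a, c, d}" "distinct [p, a, c, d]" using U' 2 by auto
      with 2 perm(3)[OF U'(3)] show ?thesis by blast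
    next
      case 3
      have "U = {p, d, a, b}" "distinct [p, d, a, b]" using U' 3 by auto
      with 3 r[OF r[OF U'(3)]] show ?thesis by blast
    next
      case 4
      have "U = {p, a, b, c}" "distinct [p, a, b, c]" using U' 4 by auto
      with 4 r[OF r[OF r[OF U'(3)]]] show ?thesis by blast
    qed
  qed
  then obtain b c d where U': "U = {p, b, c, d}" "distinct [p, b, c, d]" "Q p b c d" by blast
  have "\<exists>c d. U = {p, q, c, d} \<and> distinct [p, q, c, d] \<and> Q p q c d"
  proof -
    consider "q = b" | "q = c" | "q = d" using pqr U' by blast
    then show ?thesis
    proof cases
      case 1 with U' show ?thesis by blast
    next
      case 2
      have "U = {p, q, b, d}" "distinct [p, q, b, d]" using U' 2 by auto
      with 2 perm(1)[OF U'(3)] show ?thesis by blast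
    next
      case 3
      have "U = {p, q, b, c}" "distinct [p, q, b, c]" using U' 3 by auto
      with 3 perm(1)[OF perm(2)[OF U'(3)]] show ?thesis by blast
    qed
  qed
  then obtain c d where U': "U = {p, q, c, d}" "distinct [p, q, c, d]" "Q p q c d" by blast
  consider "r = c" | "r = d" using pqr U' by blast
  then show ?thesis
  proof cases
    case 1 with U' show ?thesis by blast
  next
    case 2
    have "U = {p, q, r, c}" "distinct [p, q, r, c]" using U' 2 by auto
    with 2 perm(2)[OF U'(3)] show ?thesis by blast
  qed
qed

text \<open>The fourth element determined by three distinct ones is new: \<open>Q p q r r\<close> would force
  \<open>p = q\<close> by \<open>skein_eq\<close>.\<close>
lemma skein_SQS:
  assumes fin: "finite X" and Q: "skein X Q"
  shows "SQS (card X) X (quads Q)"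
  unfolding SQS_def
proof (intro conjI ballI allI impI)
  show "finite X" "card X = card X" using fin by simp_all
next
  fix B assume "B \<in> quads Q"
  then show "B \<subseteq> X" "card B = 4"
    using skein_in[OF Q] unfolding quads_def by auto
next
  fix T assume "T \<subseteq> X \<and> card T = 3"
  then obtain p q r where T: "T = {p, q, r}" "p \<noteq> q" "p \<noteq> r" "q \<noteq> r" and X: "p \<in> X" "q \<in> X" "r \<in> X"
    by (auto simp: card_3_iff)
  obtain s where s: "Q p q r s" using skein_ex[OF Q X] by blast
  have "s \<noteq> r" using skein_eq[OF Q, of r p q] s T skein_rot[OF Q] by metis
  moreover have "s \<noteq> p" using skein_eq[OF Q, of p q r] s T skein_rot[OF Q] by metis
  moreover have "s \<noteq> q" using skein_eq[OF Q, of q p r] s T skein_rot[OF Q] skein_swap[OF Q] by metis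
  ultimately have d: "distinct [p, q, r, s]" using T by simp
  show "\<exists>!B. B \<in> quads Q \<and> T \<subseteq> B"
  proof (rule ex1I[of _ "{p, q, r, s}"])
    show "{p, q, r, s} \<in> quads Q \<and> T \<subseteq> {p, q, r, s}"
      using d s T(1) unfolding quads_def by blast
    fix B assume "B \<in> quads Q \<and> T \<subseteq> B"
    then have B: "B \<in> quads Q" "p \<in> B" "q \<in> B" "r \<in> B" using T(1) by auto
    show "B = {p, q, r, s}"
      using quads_complete[OF Q B T(2-4)] skein_unique[OF Q s] by blast
  qed
qed

lemma derived_quads:
  assumes Q: "skein X Q"
  shows "derived_blocks (quads Q) p = {{q, r, s} | q r s. distinct [p, q, r, s] \<and> Q p q r s}"
proof (intro equalityI subsetI)
  fix U assume "U \<in> derived_blocks (quads Q) p"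
  then obtain B where B: "B \<in> quads Q" "p \<in> B" "U = B - {p}" unfolding derived_blocks_def by blast
  have "card B = 4" using B(1) unfolding quads_def by auto
  then have "card U = 3" using B by (simp add: card_Diff_singleton)
  then obtain q r where qr: "q \<in> U" "r \<in> U" "q \<noteq> r" by (auto simp: card_3_iff)
  then obtain s where s: "B = {p, q, r, s} \<and> distinct [p, q, r, s] \<and> Q p q r s"
    using quads_complete[OF Q B(1,2), of q r] B(3) by auto
  have "U = {q, r, s}" using s B(3) by auto
  with s show "U \<in> {{q, r, s} | q r s. distinct [p, q, r, s] \<and> Q p q r s}" by blast
next
  fix U assume "U \<in> {{q, r, s} | q r s. distinct [p, q, r, s] \<and> Q p q r s}"
  then obtain q r s where *: "U = {q, r, s}" "distinct [p, q, r, s]" "Q p q r s" by blast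
  then have "{p, q, r, s} \<in> quads Q" unfolding quads_def by blast
  moreover have "U = {p, q, r, s} - {p}" using * by auto
  ultimately show "U \<in> derived_blocks (quads Q) p" unfolding derived_blocks_def by blast
qed

definition block_rel :: "'a set \<Rightarrow> 'a set set \<Rightarrow> 'a \<Rightarrow> 'a \<Rightarrow> 'a \<Rightarrow> 'a \<Rightarrow> bool" where
  "block_rel X \<B> x y z w \<longleftrightarrow> {x, y, z, w} \<subseteq> X \<and>
     (x = y \<and> z = w \<or> x = z \<and> y = w \<or> x = w \<and> y = z \<or>
      distinct [x, y, z, w] \<and> {x, y, z, w} \<in> \<B>)"

lemma SQS_skein:
  assumes "SQS v X \<B>"
  shows "skein X (block_rel X \<B>)"
proof -
  have B: "B \<subseteq> X" "card B = 4" if "B \<in> \<B>" for B using assms that unfolding SQS_def by auto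
  have u: "\<exists>!B. B \<in> \<B> \<and> T \<subseteq> B" if "T \<subseteq> X" "card T = 3" for T
    using assms that unfolding SQS_def by blast
  have ex: "\<exists>!w. block_rel X \<B> x y z w" if X: "x \<in> X" "y \<in> X" "z \<in> X" for x y z
  proof (cases "distinct [x, y, z]")
    case False
    then consider "x = y" | "x = z" "x \<noteq> y" | "y = z" "x \<noteq> y" by auto
    then show ?thesis
    proof cases
      case 1 then show ?thesis
        by (intro ex1I[of _ z]) (use X in \<open>auto simp: block_rel_def\<close>)
    next
      case 2 then show ?thesis
        by (intro ex1I[of _ y]) (use X in \<open>auto simp: block_rel_def\<close>)
    next
      case 3 then show ?thesis
        by (intro ex1I[of _ x]) (use X in \<open>auto simp: block_rel_def\<close>)
    qed
  next
    case True
    then have "{x, y, z} \<subseteq> X" "card {x, y, z} = 3" using X by auto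
    from u[OF this] obtain B0 where
      B0': "B0 \<in> \<B> \<and> {x, y, z} \<subseteq> B0 \<and> (\<forall>B. B \<in> \<B> \<and> {x, y, z} \<subseteq> B \<longrightarrow> B = B0)"
      unfolding Ex1_def by (elim exE) (rule that, simp only: conj_assoc)
    then have B0: "B0 \<in> \<B>" "{x, y, z} \<subseteq> B0" by simp_all
    have uB: "B = B0" if "B \<in> \<B>" "{x, y, z} \<subseteq> B" for B
      using B0' that by blast
    have "card (B0 - {x, y, z}) = 1"
      using B[OF B0(1)] B0(2) True by (subst card_Diff_subset) auto
    then obtain w where w: "B0 - {x, y, z} = {w}" by (auto simp: card_1_singleton_iff)
    then have B0': "B0 = {x, y, z, w}" "w \<notin> {x, y, z}" using B0 by auto
    show ?thesis
    proof (rule ex1I[of _ w])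
      show "block_rel X \<B> x y z w"
        using B0 B0' B[OF B0(1)] True X unfolding block_rel_def by auto
      fix w' assume "block_rel X \<B> x y z w'"
      then have "distinct [x, y, z, w']" "{x, y, z, w'} \<in> \<B>"
        using True unfolding block_rel_def by auto
      then show "w' = w" using uB[of "{x, y, z, w'}"] w by auto
    qed
  qed
  have sym: "block_rel X \<B> y x z w \<and> block_rel X \<B> y z w x" if "block_rel X \<B> x y z w" for x y z w
  proof -
    have e: "{y, x, z, w} = {x, y, z, w}" "{y, z, w, x} = {x, y, z, w}" by auto
    show ?thesis using that unfolding block_rel_def e by (elim conjE disjE; simp) metis
  qed
  have sub: "{x, y, z, w} \<subseteq> X" if "block_rel X \<B> x y z w" for x y z w
    using that unfolding block_rel_def by blast
  have pair: "block_rel X \<B> x x y y" if "x \<in> X" "y \<in> X" for x y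
    using that by (simp add: block_rel_def)
  show ?thesis
    by (rule skeinI) (fact sub ex pair sym[THEN conjunct1] sym[THEN conjunct2])+
qed

section \<open>The product with the field of four elements\<close>

definition prod_rel :: "('a \<Rightarrow> 'a \<Rightarrow> 'a \<Rightarrow> 'a \<Rightarrow> bool) \<Rightarrow>
    'a \<times> gf4 \<Rightarrow> 'a \<times> gf4 \<Rightarrow> 'a \<times> gf4 \<Rightarrow> 'a \<times> gf4 \<Rightarrow> bool" where
  "prod_rel Q p q r s \<longleftrightarrow> Q (fst p) (fst q) (fst r) (fst s) \<and> snd p + snd q + snd r + snd s = 0"

lemma skein_prod:
  assumes Q: "skein X Q"
  shows "skein (X \<times> UNIV) (prod_rel Q)"
proof (rule skeinI)
  fix x y z w assume *: "prod_rel Q x y z w"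
  then have q: "Q (fst x) (fst y) (fst z) (fst w)" and g: "snd x + snd y + snd z + snd w = 0"
    unfolding prod_rel_def by auto
  show "{x, y, z, w} \<subseteq> X \<times> UNIV" using skein_in[OF Q q] by (simp add: mem_Times_iff)
  show "prod_rel Q y x z w" using skein_swap[OF Q q] g by (simp add: prod_rel_def add_ac)
  show "prod_rel Q y z w x" using skein_rot[OF Q q] g by (simp add: prod_rel_def add_ac)
next
  fix x y z assume "x \<in> X \<times> (UNIV :: gf4 set)" "y \<in> X \<times> (UNIV :: gf4 set)" "z \<in> X \<times> (UNIV :: gf4 set)"
  then have "fst x \<in> X" "fst y \<in> X" "fst z \<in> X" by (simp_all add: mem_Times_iff)
  from skein_ex[OF Q this] obtain w where w: "Q (fst x) (fst y) (fst z) w" ..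
  show "\<exists>!w. prod_rel Q x y z w"
  proof (rule ex1I[of _ "(w, snd x + snd y + snd z)"])
    show "prod_rel Q x y z (w, snd x + snd y + snd z)"
      using w by (simp add: prod_rel_def gf4_add_self)
    fix w' assume w': "prod_rel Q x y z w'"
    then have "fst w' = w" using skein_unique[OF Q w] unfolding prod_rel_def by metis
    moreover have "snd x + snd y + snd z = snd w'"
      unfolding gf4_eq_iff_add[of "snd x + snd y + snd z" "snd w'"] using w' unfolding prod_rel_def by simp
    ultimately show "w' = (w, snd x + snd y + snd z)" by (simp add: prod_eq_iff)
  qed
next
  fix x y :: "'a \<times> gf4" assume "x \<in> X \<times> (UNIV :: gf4 set)" "y \<in> X \<times> (UNIV :: gf4 set)"
  then have "Q (fst x) (fst x) (fst y) (fst y)" using skein_pair[OF Q] by (simp add: mem_Times_iff)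
  then show "prod_rel Q x x y y" by (simp add: prod_rel_def add.assoc gf4_add_self)
qed

lemma derived_triple:
  assumes "SQS v X \<B>" "T \<in> derived_blocks \<B> x" "x \<in> X"
  shows "T \<subseteq> X - {x}" "card T = 3" "finite T"
  using assms unfolding SQS_def derived_blocks_def
  by (auto simp: card_Diff_singleton card_gt_0_iff intro: finite_subset)

lemma block_rel_derived:
  assumes "SQS v X \<B>" "x \<in> X" "distinct [x, y, z, w]"
  shows "block_rel X \<B> x y z w \<longleftrightarrow> {y, z, w} \<in> derived_blocks \<B> x"
proof -
  have "{x, y, z, w} \<in> \<B> \<longleftrightarrow> {y, z, w} \<in> derived_blocks \<B> x"
  proof
    assume "{x, y, z, w} \<in> \<B>"
    moreover have "{y, z, w} = {x, y, z, w} - {x}" using assms(3) by auto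
    ultimately show "{y, z, w} \<in> derived_blocks \<B> x" unfolding derived_blocks_def by blast
  next
    assume "{y, z, w} \<in> derived_blocks \<B> x"
    then obtain B where B: "{y, z, w} = B - {x}" "x \<in> B" "B \<in> \<B>"
      unfolding derived_blocks_def by blast
    have "B = {x, y, z, w}" using insert_Diff[OF B(2)] unfolding B(1)[symmetric] by (rule sym)
    with B(3) show "{x, y, z, w} \<in> \<B>" by (simp only:)
  qed
  moreover have "B \<subseteq> X" if "B \<in> \<B>" for B using assms(1) that unfolding SQS_def by blast
  moreover have "block_rel X \<B> x y z w \<longleftrightarrow> {x, y, z, w} \<subseteq> X \<and> {x, y, z, w} \<in> \<B>"
    using assms(3) unfolding block_rel_def by simp
  ultimately show ?thesis by metis
qed

text \<open>The three parts correspond to the ways in which \<open>block_rel X \<B> x y z w\<close> can hold: all arguments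
  equal, two pairs of equal arguments, or a genuine block, for which \<open>{y, z, w}\<close> is a triple of the
  derived design.\<close>
lemma derived_prod:
  assumes S: "SQS v X \<B>" and x: "x \<in> X"
  shows "derived_blocks (quads (prod_rel (block_rel X \<B>))) (x, i) =
    insert ({x} \<times> (- {i})) (
      {{(x, j), (y, a), (y, a + i + j)} | y j a. y \<in> X - {x} \<and> j \<noteq> i} \<union>
      {(\<lambda>y. (y, g y)) ` T | T g. T \<in> derived_blocks \<B> x \<and> (\<Sum>y\<in>T. g y) = i})"
    (is "?L = insert ?A (?V \<union> ?T)")
proof -
  note sk = SQS_skein[OF S]
  have L: "?L = {{p, q, r} | p q r. distinct [(x, i), p, q, r] \<and> prod_rel (block_rel X \<B>) (x, i) p q r}"
    by (rule derived_quads[OF skein_prod[OF sk]])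
  have two: "{(x, a), (z, b), (z, d)} \<in> insert ?A (?V \<union> ?T)"
    if "distinct [(x, i), (x, a), (z, b), (z, d)]" "i + a + b + d = 0" "z \<in> X" for a b d z
  proof (cases "z = x")
    case True
    have "card {a, b, d} = card (- {i})"
      using that(1) True by (simp add: Compl_eq_Diff_UNIV card_Diff_subset card_gf4)
    then have "{a, b, d} = - {i}" using that(1) True by (intro card_subset_eq) auto
    then have "{(x, a), (z, b), (z, d)} = ?A" using True by auto
    then show ?thesis by simp
  next
    case False
    have "d = b + i + a"
      by (rule iffD2[OF gf4_eq_iff_add]) (use that(2) in \<open>simp add: ac_simps\<close>)
    moreover have "a \<noteq> i" using that(1) by auto
    ultimately have "{(x, a), (z, b), (z, d)} \<in> ?V" using that(3) False by blast
    then show ?thesis by simp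
  qed
  show ?thesis
  proof (intro equalityI subsetI)
    fix U assume "U \<in> ?L"
    then obtain p q r where U: "U = {p, q, r}" "distinct [(x, i), p, q, r]"
      "prod_rel (block_rel X \<B>) (x, i) p q r" unfolding L by blast
    obtain y a z b w d where pqr: "p = (y, a)" "q = (z, b)" "r = (w, d)" by (metis prod.exhaust)
    have rel: "block_rel X \<B> x y z w" and sum: "i + a + b + d = 0"
      using U(3) unfolding prod_rel_def pqr by simp_all
    from rel have X: "y \<in> X" "z \<in> X" "w \<in> X"
      and cases: "x = y \<and> z = w \<or> x = z \<and> y = w \<or> x = w \<and> y = z \<or> distinct [x, y, z, w]"
      unfolding block_rel_def by auto
    from cases consider "x = y" "z = w" | "x = z" "y = w" | "x = w" "y = z" | "distinct [x, y, z, w]" by blast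
    then show "U \<in> insert ?A (?V \<union> ?T)"
    proof cases
      case 1
      show ?thesis using two[of a z b d] U(2) sum X 1 unfolding U(1) pqr by simp
    next
      case 2
      have "distinct [(x, i), (x, b), (y, a), (y, d)]" using U(2) unfolding pqr 2 by auto
      then have "{(x, b), (y, a), (y, d)} \<in> insert ?A (?V \<union> ?T)"
        using sum X by (intro two) (simp_all add: ac_simps)
      moreover have "U = {(x, b), (y, a), (y, d)}" unfolding U(1) pqr using 2 by auto
      ultimately show ?thesis by (simp only:)
    next
      case 3
      have "distinct [(x, i), (x, d), (y, a), (y, b)]" using U(2) unfolding pqr 3 by auto
      then have "{(x, d), (y, a), (y, b)} \<in> insert ?A (?V \<union> ?T)"
        using sum X by (intro two) (simp_all add: ac_simps)
      moreover have "U = {(x, d), (y, a), (y, b)}" unfolding U(1) pqr using 3 by auto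
      ultimately show ?thesis by (simp only:)
    next
      case 4
      define g where "g = (\<lambda>u. if u = y then a else if u = z then b else d)"
      have T: "{y, z, w} \<in> derived_blocks \<B> x" using rel block_rel_derived[OF S x 4] by blast
      have "(\<Sum>u\<in>{y, z, w}. g u) = a + b + d" using 4 by (auto simp: g_def add.assoc)
      also have "\<dots> = i" by (rule iffD2[OF gf4_eq_iff_add]) (use sum in \<open>simp add: ac_simps\<close>)
      finally have "(\<lambda>u. (u, g u)) ` {y, z, w} \<in> ?T" using T by blast
      moreover have "U = (\<lambda>u. (u, g u)) ` {y, z, w}" unfolding U(1) pqr using 4 by (auto simp: g_def)
      ultimately show ?thesis by simp
    qed
  next
    have LI: "{p, q, r} \<in> ?L"
      if "distinct [(x, i), p, q, r]" "block_rel X \<B> x (fst p) (fst q) (fst r)" "i + snd p + snd q + snd r = 0"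
      for p q r
    proof -
      have "prod_rel (block_rel X \<B>) (x, i) p q r" using that(2,3) by (simp add: prod_rel_def)
      with that(1) show ?thesis unfolding L by blast
    qed
    fix U assume "U \<in> insert ?A (?V \<union> ?T)"
    then consider "U = ?A" | "U \<in> ?V" | "U \<in> ?T" by blast
    then show "U \<in> ?L"
    proof cases
      case 1
      have "card (- {i}) = 3" by (simp add: Compl_eq_Diff_UNIV card_Diff_subset card_gf4)
      then obtain a b d where abd: "- {i} = {a, b, d}" "a \<noteq> b" "a \<noteq> d" "b \<noteq> d"
        by (auto simp: card_3_iff)
      have ni: "a \<noteq> i" "b \<noteq> i" "d \<noteq> i" using abd(1) by auto
      have "UNIV = {i, a, b, d}" using abd(1) by auto
      \<comment> \<open>All field elements sum to zero, so the three elements other than \<open>i\<close> complete it to a block.\<close>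
      then have "(\<Sum>u\<in>UNIV. u) = (\<Sum>u\<in>{i, a, b, d}. u)" by simp
      also have "\<dots> = i + a + b + d" using abd ni by (auto simp: add.assoc)
      finally have "i + a + b + d = 0" by (simp add: UNIV_gf4 zero_gf4_def)
      moreover have "U = {(x, a), (x, b), (x, d)}" unfolding 1 abd(1) by auto
      moreover have "block_rel X \<B> x x x x" using x by (simp add: block_rel_def)
      ultimately show ?thesis using LI[of "(x, a)" "(x, b)" "(x, d)"] abd(2-4) ni by auto
    next
      case 2
      then obtain y j a where U: "U = {(x, j), (y, a), (y, a + i + j)}" "y \<in> X" "y \<noteq> x" "j \<noteq> i" by blast
      have "i + j \<noteq> 0" using U(4) gf4_eq_iff_add[of i j] by auto
      then have "distinct [(x, i), (x, j), (y, a), (y, a + i + j)]" using U by (auto simp: add.assoc)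
      moreover have "i + j + a + (a + i + j) = (i + j) + (i + j) + (a + a)" by (simp only: ac_simps)
      then have "i + j + a + (a + i + j) = 0" by (simp only: gf4_add_self)
      moreover have "block_rel X \<B> x x y y" using x U by (simp add: block_rel_def)
      ultimately show ?thesis using LI[of "(x, j)" "(y, a)" "(y, a + i + j)"] unfolding U(1) by simp
    next
      case 3
      then obtain T g where T: "U = (\<lambda>y. (y, g y)) ` T" "T \<in> derived_blocks \<B> x" "(\<Sum>y\<in>T. g y) = i" by blast
      note DT = derived_triple[OF S T(2) x]
      obtain y z w where yzw: "T = {y, z, w}" "y \<noteq> z" "y \<noteq> w" "z \<noteq> w" using DT(2) by (auto simp: card_3_iff)
      have d: "distinct [x, y, z, w]" using DT(1) yzw by auto
      have "g y + g z + g w = i" using T(3) yzw by (auto simp: add.assoc)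
      then have "i + g y + g z + g w = 0" by (metis add.assoc gf4_add_self)
      moreover have "block_rel X \<B> x y z w" using block_rel_derived[OF S x d] T(2) yzw(1) by simp
      ultimately show ?thesis
        using LI[of "(y, g y)" "(z, g z)" "(w, g w)"] d unfolding T(1) yzw(1) by auto
    qed
  qed
qed

section \<open>Resolving the derived designs of the product\<close>

lemma partition_on_ex1:
  assumes "\<And>B. B \<in> P \<Longrightarrow> B \<noteq> {} \<and> B \<subseteq> Y" "\<And>y. y \<in> Y \<Longrightarrow> \<exists>!B. B \<in> P \<and> y \<in> B"
  shows "partition_on Y P"
proof (rule partition_onI)
  show "\<Union>P = Y" using assms by blast
  show "{} \<notin> P" using assms(1) by blast
  show "disjnt p q" if "p \<in> P" "q \<in> P" "p \<noteq> q" for p q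
    using that assms unfolding disjnt_iff by blast
qed

lemma partition_on_ex1D:
  assumes "partition_on Y P" "y \<in> Y"
  shows "\<exists>!B. B \<in> P \<and> y \<in> B"
  using assms unfolding partition_on_def disjoint_def by blast

text \<open>Distinct indices automatically give distinct classes, since a class is nonempty and each of its
  blocks determines the index.\<close>
lemma resolvable_family:
  assumes "Y \<noteq> {}" and F: "\<And>s. s \<in> S \<Longrightarrow> partition_on Y (F s) \<and> F s \<subseteq> \<C>"
    and ex1: "\<And>B. B \<in> \<C> \<Longrightarrow> \<exists>!s. s \<in> S \<and> B \<in> F s"
  shows "resolvable Y \<C>"
  unfolding resolvable_def
proof (intro exI conjI ballI)
  show "partition_on \<C> (F ` S)"
  proof (rule partition_on_ex1)
    fix P assume "P \<in> F ` S"
    then obtain s where s: "s \<in> S" "P = F s" by blast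
    have P: "partition_on Y P" "P \<subseteq> \<C>" using F[OF s(1)] s(2) by simp_all
    have "P \<noteq> {}" using partition_onD1[OF P(1)] assms(1) by auto
    with P(2) show "P \<noteq> {} \<and> P \<subseteq> \<C>" by simp
  next
    fix B assume "B \<in> \<C>"
    from ex1[OF this] obtain s where s: "s \<in> S \<and> B \<in> F s"
      and u: "\<forall>s'. s' \<in> S \<and> B \<in> F s' \<longrightarrow> s' = s" by (rule ex1E)
    have "F s \<in> F ` S \<and> B \<in> F s" using s by simp
    moreover have "P = F s" if "P \<in> F ` S \<and> B \<in> P" for P using that u by blast
    ultimately show "\<exists>!P. P \<in> F ` S \<and> B \<in> P" by (rule ex1I)
  qed
  show "parallel_class Y \<C> P" if "P \<in> F ` S" for P
    using that F unfolding parallel_class_def by blast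
qed

lemma bij_betw_ex1:
  assumes f: "bij_betw f A B" and "b \<in> B"
  shows "\<exists>!a. a \<in> A \<and> f a = b"
proof -
  have "b \<in> f ` A" using assms by (simp add: bij_betw_def)
  then obtain a where "a \<in> A \<and> f a = b" by blast
  then show ?thesis
    using inj_onD[OF bij_betw_imp_inj_on[OF f]] by (intro ex1I[of _ a]) auto
qed

text \<open>The local data at \<open>x\<close>, freed from counting. The set \<open>I\<close> consists of the slots, \<open>R s\<close> is the
  old parallel class underlying the slot \<open>s\<close>, and \<open>c s\<close> is its only triple in \<open>P'\<close>. The
  bijections \<open>h T\<close> and \<open>k\<close> encode that a triple outside \<open>P'\<close> lies in four slots and that
  a triple of \<open>P'\<close> lies in six.\<close>
locale labelled_star =
  fixes x :: 'a and Z :: "'a set" and D P' :: "'a set set"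
    and I :: "'s set" and c :: "'s \<Rightarrow> 'a set" and R :: "'s \<Rightarrow> 'a set set"
    and \<mu> :: "'a set \<Rightarrow> 'a \<Rightarrow> gf4" and h :: "'a set \<Rightarrow> 's \<Rightarrow> gf4" and k :: "'s \<Rightarrow> gf4 set"
    and i :: gf4
  assumes x_notin: "x \<notin> Z"
    and D_sub: "\<And>T. T \<in> D \<Longrightarrow> T \<subseteq> Z"
    and P'_part: "partition_on Z P'" and P'_D: "P' \<subseteq> D"
    and R_part: "\<And>s. s \<in> I \<Longrightarrow> partition_on Z (R s)"
    and R_D: "\<And>s. s \<in> I \<Longrightarrow> R s \<subseteq> D"
    and c_P': "\<And>s. s \<in> I \<Longrightarrow> c s \<in> P'"
    and R_P': "\<And>s T. s \<in> I \<Longrightarrow> T \<in> P' \<Longrightarrow> T \<in> R s \<longleftrightarrow> T = c s"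
    and \<mu>_bij: "\<And>T. T \<in> D \<Longrightarrow> bij_betw (\<mu> T) T (- {0})"
    and h_bij: "\<And>T. T \<in> D - P' \<Longrightarrow> bij_betw (h T) {s \<in> I. T \<in> R s} UNIV"
    and k_bij: "\<And>T. T \<in> P' \<Longrightarrow> bij_betw k {s \<in> I. c s = T} {A. card A = 2}"
begin

definition graph :: "'a set \<Rightarrow> gf4 \<Rightarrow> gf4 \<Rightarrow> ('a \<times> gf4) set" where
  "graph T \<alpha> \<beta> = (\<lambda>y. (y, i + \<alpha> * \<mu> T y + \<beta> * (\<mu> T y)\<^sup>2)) ` T"

text \<open>The coefficient \<open>\<alpha>\<close> of the graph over \<open>T\<close> with given \<open>\<beta>\<close> through the point \<open>(y, a)\<close>.\<close>
definition slope :: "'a set \<Rightarrow> gf4 \<Rightarrow> 'a \<Rightarrow> gf4 \<Rightarrow> gf4" where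
  "slope T \<beta> y a = (a + i + \<beta> * (\<mu> T y)\<^sup>2) / \<mu> T y"

text \<open>The points over \<open>y\<close> that the graphs with \<open>\<alpha> \<in> A\<close> leave uncovered, completed to a triple by a
  point over \<open>x\<close>.\<close>
definition vert :: "'a set \<Rightarrow> gf4 set \<Rightarrow> 'a \<Rightarrow> ('a \<times> gf4) set" where
  "vert T A y = insert (x, i + \<Sum>A * \<mu> T y)
     ((\<lambda>\<alpha>. (y, i + \<alpha> * \<mu> T y + \<Sum>A * (\<mu> T y)\<^sup>2)) ` (- A))"

definition apex :: "('a \<times> gf4) set" where
  "apex = {x} \<times> (- {i})"

text \<open>A slot uses the triple \<open>c s\<close> to absorb the points over \<open>x\<close> and fills up with graphs over the
  other triples of \<open>R s\<close>. The additional class \<open>None\<close> collects the graphs with \<open>\<beta> = 0\<close> over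
  \<open>P'\<close>, which no slot uses because the sum of two distinct elements is nonzero.\<close>
definition slot_class :: "'s option \<Rightarrow> ('a \<times> gf4) set set" where
  "slot_class t = (case t of
     None \<Rightarrow> insert apex {graph T \<alpha> 0 | T \<alpha>. T \<in> P'}
   | Some s \<Rightarrow> {graph (c s) \<alpha> (\<Sum>(k s)) | \<alpha>. \<alpha> \<in> k s} \<union> {vert (c s) (k s) y | y. y \<in> c s} \<union>
       {graph T \<alpha> (h T s) | T \<alpha>. T \<in> R s - {c s}})"

definition points :: "('a \<times> gf4) set" where
  "points = insert x Z \<times> UNIV - {(x, i)}"

definition vpairs :: "('a \<times> gf4) set set" where
  "vpairs = {{(x, j), (y, a), (y, a + i + j)} | y j a. y \<in> Z \<and> j \<noteq> i}"

definition transversals :: "('a \<times> gf4) set set" where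
  "transversals = {(\<lambda>y. (y, g y)) ` T | T g. T \<in> D \<and> (\<Sum>y\<in>T. g y) = i}"

lemma \<mu>_nonzero: "T \<in> D \<Longrightarrow> y \<in> T \<Longrightarrow> \<mu> T y \<noteq> 0"
  using \<mu>_bij[of T] by (auto simp: bij_betw_def)

lemma x_notin_D: "T \<in> D \<Longrightarrow> x \<notin> T"
  using D_sub x_notin by blast

lemma mem_graph:
  assumes "T \<in> D"
  shows "(y, a) \<in> graph T \<alpha> \<beta> \<longleftrightarrow> y \<in> T \<and> \<alpha> = slope T \<beta> y a"
proof -
  have "(y, a) \<in> graph T \<alpha> \<beta> \<longleftrightarrow> y \<in> T \<and> a = i + \<alpha> * \<mu> T y + \<beta> * (\<mu> T y)\<^sup>2"
    unfolding graph_def by blast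
  then show ?thesis using gf4_solve[OF \<mu>_nonzero[OF assms]] unfolding slope_def by blast
qed

lemma mem_vert:
  assumes "T \<in> D" "y \<in> T" "z \<noteq> x"
  shows "(z, a) \<in> vert T A y \<longleftrightarrow> z = y \<and> slope T (\<Sum>A) y a \<notin> A"
proof -
  have "(z, a) \<in> vert T A y \<longleftrightarrow> z = y \<and> (\<exists>\<alpha>\<in>- A. a = i + \<alpha> * \<mu> T y + \<Sum>A * (\<mu> T y)\<^sup>2)"
    using assms(3) unfolding vert_def by blast
  then show ?thesis by (simp add: gf4_solve[OF \<mu>_nonzero[OF assms(1,2)]] slope_def)
qed

lemma mem_vert_x:
  assumes "T \<in> D" "y \<in> T"
  shows "(x, j) \<in> vert T A y \<longleftrightarrow> j = i + \<Sum>A * \<mu> T y"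
  using assms x_notin_D unfolding vert_def by auto

lemma fst_graph: "fst ` graph T \<alpha> \<beta> = T"
  unfolding graph_def by (simp add: image_image)

lemma ex1_vert_x:
  assumes "T \<in> D" "\<beta> \<noteq> 0" "j \<noteq> i"
  shows "\<exists>!y. y \<in> T \<and> j = i + \<beta> * \<mu> T y"
proof -
  have *: "j = i + \<beta> * m \<longleftrightarrow> m = (i + j) / \<beta>" for m
  proof -
    have "j = i + \<beta> * m \<longleftrightarrow> j + i = \<beta> * m" by (rule gf4_add_move[symmetric])
    also have "\<dots> \<longleftrightarrow> m * \<beta> = i + j" by (auto simp only: mult.commute add.commute)
    also have "\<dots> \<longleftrightarrow> m = (i + j) / \<beta>" using assms(2) by (simp add: nonzero_eq_divide_eq)
    finally show ?thesis .
  qed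
  have "(i + j) / \<beta> \<in> - {0}" using assms by (simp add: gf4_eq_iff_add[of j i] add.commute)
  from bij_betw_ex1[OF \<mu>_bij[OF assms(1)] this] show ?thesis by (simp only: *)
qed

lemma card_k:
  assumes "s \<in> I"
  shows "card (k s) = 2"
proof -
  have "s \<in> {s' \<in> I. c s' = c s}" using assms by simp
  from bij_betw_apply[OF k_bij[OF c_P'[OF assms]] this] show ?thesis by simp
qed

lemma P'_sub: "T \<in> P' \<Longrightarrow> T \<in> D"
  using P'_D by blast

lemma c_D: "s \<in> I \<Longrightarrow> c s \<in> D"
  using c_P' P'_D by blast

lemma c_R: "s \<in> I \<Longrightarrow> c s \<in> R s"
  using R_P' c_P' by blast

lemma triple_nonempty: "T \<in> D \<Longrightarrow> T \<noteq> {}"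
  using \<mu>_bij[of T] by (auto simp: bij_betw_def nonzero_gf4)

lemma graph_points:
  assumes "T \<in> D"
  shows "graph T \<alpha> \<beta> \<noteq> {} \<and> graph T \<alpha> \<beta> \<subseteq> points"
  using triple_nonempty[OF assms] D_sub[OF assms] x_notin unfolding graph_def points_def by auto

lemma vert_points:
  assumes "T \<in> D" "y \<in> T" "card A = 2"
  shows "vert T A y \<noteq> {} \<and> vert T A y \<subseteq> points"
proof -
  have "i + \<Sum>A * \<mu> T y \<noteq> i" using pair_sum_nonzero[OF assms(3)] \<mu>_nonzero[OF assms(1,2)] by simp
  moreover have "y \<in> Z" "y \<noteq> x" using D_sub[OF assms(1)] assms(2) x_notin by auto
  ultimately show ?thesis unfolding vert_def points_def by auto
qed

lemma slot_class_Some_cases: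
  assumes "B \<in> slot_class (Some s)"
  obtains \<alpha> where "\<alpha> \<in> k s" "B = graph (c s) \<alpha> (\<Sum>(k s))"
  | y where "y \<in> c s" "B = vert (c s) (k s) y"
  | T \<alpha> where "T \<in> R s" "T \<noteq> c s" "B = graph T \<alpha> (h T s)"
  using assms unfolding slot_class_def by auto

lemma slot_class_None_cases:
  assumes "B \<in> slot_class None"
  obtains "B = apex" | T \<alpha> where "T \<in> P'" "B = graph T \<alpha> 0"
  using assms unfolding slot_class_def by auto

lemma partition_None: "partition_on points (slot_class None)"
proof (rule partition_on_ex1)
  fix B assume "B \<in> slot_class None"
  then show "B \<noteq> {} \<and> B \<subseteq> points"
  proof (cases rule: slot_class_None_cases)
    case 1
    obtain j where "j \<noteq> i" by (metis zero_neq_one)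
    then have "j \<in> - {i}" by simp
    then show ?thesis unfolding 1 apex_def points_def by auto
  next
    case 2
    then show ?thesis using graph_points P'_sub by simp
  qed
next
  fix p assume "p \<in> points"
  then obtain y a where p: "p = (y, a)" "y = x \<and> a \<noteq> i \<or> y \<in> Z"
    unfolding points_def by auto
  show "\<exists>!B. B \<in> slot_class None \<and> p \<in> B"
  proof (cases "y = x")
    case True
    show ?thesis
    proof (rule ex1I[of _ apex])
      show "apex \<in> slot_class None \<and> p \<in> apex"
        using p True x_notin unfolding apex_def slot_class_def by auto
      fix B assume "B \<in> slot_class None \<and> p \<in> B"
      then have "B \<in> slot_class None" "p \<in> B" by auto
      then show "B = apex"
        by (cases rule: slot_class_None_cases) (auto simp: p True mem_graph P'_sub dest: x_notin_D[OF P'_sub])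
    qed
  next
    case False
    with p have "y \<in> Z" by simp
    from partition_on_ex1D[OF P'_part this] obtain T
      where T: "T \<in> P' \<and> y \<in> T" and uT: "\<forall>T'. T' \<in> P' \<and> y \<in> T' \<longrightarrow> T' = T" by (rule ex1E)
    let ?G = "graph T (slope T 0 y a) 0"
    show ?thesis
    proof (rule ex1I[of _ ?G])
      show "?G \<in> slot_class None \<and> p \<in> ?G"
        using T unfolding p(1) mem_graph[OF P'_sub[OF conjunct1[OF T]]] unfolding slot_class_def by auto
      fix B assume "B \<in> slot_class None \<and> p \<in> B"
      then have "B \<in> slot_class None" and pB: "p \<in> B" by auto
      then show "B = ?G"
      proof (cases rule: slot_class_None_cases)
        case 1
        then show ?thesis using pB p(1) False unfolding apex_def by simp
      next
        case (2 T' \<alpha>)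
        have *: "y \<in> T'" "\<alpha> = slope T' 0 y a"
          using pB unfolding p(1) 2(2) mem_graph[OF P'_sub[OF 2(1)]] by auto
        then have "T' = T" using uT 2(1) by blast
        then show ?thesis using * 2 by simp
      qed
    qed
  qed
qed

text \<open>A point \<open>(x, a)\<close> lies on the vertical triple over the point with label \<open>(a + i) / \<Sum>(k s)\<close>.
  A point over \<open>c s\<close> lies on a graph or on a vertical triple according to whether its slope
  belongs to \<open>k s\<close>.\<close>
lemma partition_Some:
  assumes s: "s \<in> I"
  shows "partition_on points (slot_class (Some s))"
proof (rule partition_on_ex1)
  note k2 = card_k[OF s]
  fix B assume "B \<in> slot_class (Some s)"
  then show "B \<noteq> {} \<and> B \<subseteq> points"
  proof (cases rule: slot_class_Some_cases)
    case 1
    then show ?thesis using graph_points[OF c_D[OF s]] by simp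
  next
    case 2
    then show ?thesis using vert_points[OF c_D[OF s] _ k2] by simp
  next
    case 3
    then show ?thesis using graph_points R_D[OF s] by blast
  qed
next
  let ?T0 = "c s" and ?\<beta> = "\<Sum>(k s)"
  note k2 = card_k[OF s] and D0 = c_D[OF s]
  fix p assume "p \<in> points"
  then obtain y a where p: "p = (y, a)" "y = x \<and> a \<noteq> i \<or> y \<in> Z"
    unfolding points_def by auto
  show "\<exists>!B. B \<in> slot_class (Some s) \<and> p \<in> B"
  proof (cases "y = x")
    case True
    then have "a \<noteq> i" using p x_notin by auto
    from ex1_vert_x[OF D0 pair_sum_nonzero[OF k2] this] obtain z
      where z: "z \<in> ?T0 \<and> a = i + ?\<beta> * \<mu> ?T0 z"
        and uz: "\<forall>z'. z' \<in> ?T0 \<and> a = i + ?\<beta> * \<mu> ?T0 z' \<longrightarrow> z' = z" by (rule ex1E)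
    show ?thesis
    proof (rule ex1I[of _ "vert ?T0 (k s) z"])
      have "vert ?T0 (k s) z \<in> slot_class (Some s)" using z unfolding slot_class_def by auto
      moreover have "p \<in> vert ?T0 (k s) z"
        unfolding p(1) True using mem_vert_x[OF D0 conjunct1[OF z]] z by blast
      ultimately show "vert ?T0 (k s) z \<in> slot_class (Some s) \<and> p \<in> vert ?T0 (k s) z" ..
      fix B assume "B \<in> slot_class (Some s) \<and> p \<in> B"
      then have B: "B \<in> slot_class (Some s)" and pB: "(x, a) \<in> B" using p(1) True by auto
      from B show "B = vert ?T0 (k s) z"
      proof (cases rule: slot_class_Some_cases)
        case 1
        then show ?thesis using pB mem_graph[OF D0] x_notin_D[OF D0] by blast
      next
        case (2 z')
        then show ?thesis using pB mem_vert_x[OF D0 2(1)] uz by blast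
      next
        case (3 T \<alpha>)
        then have "T \<in> D" using R_D[OF s] by blast
        then show ?thesis using 3 pB mem_graph x_notin_D by blast
      qed
    qed
  next
    case False
    with p have "y \<in> Z" by simp
    from partition_on_ex1D[OF R_part[OF s] this] obtain T
      where T: "T \<in> R s \<and> y \<in> T" and uT: "\<forall>T'. T' \<in> R s \<and> y \<in> T' \<longrightarrow> T' = T" by (rule ex1E)
    have in_graph: "p \<in> graph T' \<alpha> \<beta> \<longleftrightarrow> T' = T \<and> \<alpha> = slope T \<beta> y a" if "T' \<in> R s" for T' \<alpha> \<beta>
    proof -
      have "T' \<in> D" using that R_D[OF s] by blast
      from mem_graph[OF this] show ?thesis using uT T that unfolding p(1) by blast
    qed
    have in_vert: "p \<in> vert ?T0 (k s) z \<longleftrightarrow> T = ?T0 \<and> z = y \<and> slope T ?\<beta> y a \<notin> k s" if "z \<in> ?T0" for z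
      using mem_vert[OF D0 that False] uT T that c_R[OF s] unfolding p(1) by blast
    define Bl where "Bl = (if T \<noteq> ?T0 then graph T (slope T (h T s) y a) (h T s)
      else if slope T ?\<beta> y a \<in> k s then graph T (slope T ?\<beta> y a) ?\<beta> else vert ?T0 (k s) y)"
    show ?thesis
    proof (rule ex1I[of _ Bl])
      have "Bl \<in> slot_class (Some s)"
        using T unfolding Bl_def slot_class_def by auto
      moreover have "p \<in> Bl"
        using T in_graph[of T] in_vert[of y] unfolding Bl_def by (cases "T = ?T0") auto
      ultimately show "Bl \<in> slot_class (Some s) \<and> p \<in> Bl" ..
      fix B assume "B \<in> slot_class (Some s) \<and> p \<in> B"
      then have B: "B \<in> slot_class (Some s)" and pB: "p \<in> B" by auto
      from B show "B = Bl"
      proof (cases rule: slot_class_Some_cases)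
        case (1 \<alpha>)
        then show ?thesis using pB in_graph[OF c_R[OF s]] unfolding Bl_def by auto
      next
        case (2 z)
        then show ?thesis using pB in_vert[OF 2(1)] unfolding Bl_def by auto
      next
        case (3 T' \<alpha>)
        then show ?thesis using pB in_graph[OF 3(1)] unfolding Bl_def by auto
      qed
    qed
  qed
qed

lemma graph_transversal:
  assumes "T \<in> D"
  shows "graph T \<alpha> \<beta> \<in> transversals"
proof -
  have "(\<Sum>y\<in>T. i + \<alpha> * \<mu> T y + \<beta> * (\<mu> T y)\<^sup>2) = i"
    using sum.reindex_bij_betw[OF \<mu>_bij[OF assms], of "\<lambda>u. i + \<alpha> * u + \<beta> * u\<^sup>2"]
    by (simp only: sum_quadratic_gf4)
  then show ?thesis using assms unfolding graph_def transversals_def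
    by (intro CollectI exI[of _ T] exI[of _ "\<lambda>y. i + \<alpha> * \<mu> T y + \<beta> * (\<mu> T y)\<^sup>2"] conjI refl)
qed

lemma transversal_graph:
  assumes "B \<in> transversals"
  obtains T \<alpha> \<beta> where "T \<in> D" "B = graph T \<alpha> \<beta>"
proof -
  obtain T g where T: "T \<in> D" "(\<Sum>y\<in>T. g y) = i" "B = (\<lambda>y. (y, g y)) ` T"
    using assms unfolding transversals_def by blast
  define f where "f = g \<circ> inv_into T (\<mu> T)"
  have f: "f (\<mu> T y) = g y" if "y \<in> T" for y
    using that \<mu>_bij[OF T(1)] by (simp add: f_def bij_betw_inv_into_left)
  have "(\<Sum>u\<in>- {0}. f u) = (\<Sum>y\<in>T. f (\<mu> T y))"
    by (rule sum.reindex_bij_betw[OF \<mu>_bij[OF T(1)], symmetric])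
  also have "\<dots> = i" using f T(2) by simp
  finally obtain \<alpha> \<beta> where *: "\<forall>u\<in>- {0}. f u = i + \<alpha> * u + \<beta> * u\<^sup>2"
    using interpolate_gf4[of f] by auto
  have "g y = i + \<alpha> * \<mu> T y + \<beta> * (\<mu> T y)\<^sup>2" if "y \<in> T" for y
    using bspec[OF *, of "\<mu> T y"] \<mu>_nonzero[OF T(1) that] f[OF that] by simp
  then have "B = graph T \<alpha> \<beta>" unfolding T(3) graph_def by (intro image_cong) simp_all
  with T(1) show ?thesis by (rule that)
qed

lemma graph_inj:
  assumes "T \<in> D" "graph T \<alpha> \<beta> = graph T' \<alpha>' \<beta>'"
  shows "T = T' \<and> \<alpha> = \<alpha>' \<and> \<beta> = \<beta>'"
proof -
  have T: "T = T'" using assms(2) fst_graph by metis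
  have "i + \<alpha> * u + \<beta> * u\<^sup>2 = i + \<alpha>' * u + \<beta>' * u\<^sup>2" if "u \<noteq> 0" for u
  proof -
    have "u \<in> \<mu> T ` T" using that bij_betw_imp_surj_on[OF \<mu>_bij[OF assms(1)]] by simp
    then obtain y where y: "y \<in> T" "u = \<mu> T y" by blast
    have "(y, i + \<alpha> * u + \<beta> * u\<^sup>2) \<in> graph T' \<alpha>' \<beta>'"
      unfolding assms(2)[symmetric] unfolding graph_def by (rule image_eqI[of _ _ y]) (use y in simp_all)
    then have "i + \<alpha> * u + \<beta> * u\<^sup>2 = i + \<alpha>' * \<mu> T' y + \<beta>' * (\<mu> T' y)\<^sup>2"
      unfolding graph_def by blast
    then show ?thesis unfolding y(2) T .
  qed
  then show ?thesis using quadratic_unique_gf4 T by blast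
qed

text \<open>The complement of \<open>A\<close> has the same sum as \<open>A\<close>, because all elements of the field sum to zero;
  it is thus the other coset of \<open>{0, \<Sum>A}\<close>, which explains the difference \<open>\<Sum>A * \<mu> T y\<close> of the
  two points over \<open>y\<close>.\<close>
lemma vert_explicit:
  assumes "card A = 2" "\<alpha> \<notin> A" and a: "a = i + \<alpha> * \<mu> T y + \<Sum>A * (\<mu> T y)\<^sup>2"
  shows "vert T A y = {(x, i + \<Sum>A * \<mu> T y), (y, a), (y, a + \<Sum>A * \<mu> T y)}"
proof -
  have "\<alpha> \<in> - A \<and> \<Sum>(- A) = \<Sum>A" using compl_pair[OF assms(1)] assms(2) by simp
  then have A: "- A = {\<alpha>, \<alpha> + \<Sum>A}" using pair_gf4[OF compl_pair(1)[OF assms(1)]] by blast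
  show ?thesis unfolding vert_def A a by (simp add: algebra_simps)
qed

lemma vert_vpair:
  assumes T: "T \<in> P'" "y \<in> T" and A: "card A = 2"
  shows "vert T A y \<in> vpairs"
proof -
  have TD: "T \<in> D" using P'_sub[OF T(1)] .
  have "- A \<noteq> {}" using compl_pair(1)[OF A] by auto
  then obtain \<alpha> where \<alpha>: "\<alpha> \<notin> A" by blast
  define j where "j = i + \<Sum>A * \<mu> T y"
  have j: "\<Sum>A * \<mu> T y = i + j" unfolding j_def by (simp add: gf4_add_cancel)
  have "j \<noteq> i" using pair_sum_nonzero[OF A] \<mu>_nonzero[OF TD T(2)] unfolding j_def by simp
  moreover have "y \<in> Z" using D_sub[OF TD] T(2) by blast
  moreover have "\<exists>a. vert T A y = {(x, j), (y, a), (y, a + i + j)}"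
    unfolding vert_explicit[OF A \<alpha> refl] j_def[symmetric] unfolding j by (auto simp: add.assoc)
  ultimately show ?thesis unfolding vpairs_def by blast
qed

text \<open>The point over \<open>x\<close> determines the sum of \<open>A\<close>, and the two points over \<open>y\<close> then decide which of
  the two cosets is the complement of \<open>A\<close>.\<close>
lemma vpair_vert:
  assumes "B \<in> vpairs"
  obtains T y A where "T \<in> P'" "y \<in> T" "card A = 2" "B = vert T A y"
proof -
  obtain y j a where B: "y \<in> Z" "j \<noteq> i" "B = {(x, j), (y, a), (y, a + i + j)}"
    using assms unfolding vpairs_def by blast
  obtain T where T: "T \<in> P'" "y \<in> T" using B(1) partition_onD1[OF P'_part] by blast
  have m: "\<mu> T y \<noteq> 0" using \<mu>_nonzero[OF P'_sub[OF T(1)] T(2)] .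
  define \<beta> where "\<beta> = (i + j) / \<mu> T y"
  have \<beta>m: "\<beta> * \<mu> T y = i + j" using m by (simp add: \<beta>_def)
  have \<beta>0: "\<beta> \<noteq> 0" using m B(2) gf4_eq_iff_add[of i j] by (auto simp: \<beta>_def)
  define \<alpha> where "\<alpha> = slope T \<beta> y a"
  \<comment> \<open>A vertical triple holds the values left over by \<open>A\<close>, so \<open>A\<close> is the other coset.\<close>
  define A where "A = - {\<alpha>, \<alpha> + \<beta>}"
  note c2 = card_pair[OF \<beta>0, of \<alpha>]
  have A: "card A = 2" "\<Sum>A = \<beta>" "\<alpha> \<notin> A"
    using compl_pair[OF c2] pair_gf4[OF c2, of \<alpha> \<beta>] by (auto simp: A_def)
  have a: "a = i + \<alpha> * \<mu> T y + \<beta> * (\<mu> T y)\<^sup>2"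
    unfolding gf4_solve[OF m] by (simp add: \<alpha>_def slope_def)
  have "vert T A y = B"
    unfolding vert_explicit[OF A(1,3) a[folded A(2)]] A(2) \<beta>m B(3) by (simp add: gf4_add_cancel add.assoc)
  with T A(1) show ?thesis using that by blast
qed

lemma fst_vert: "card A = 2 \<Longrightarrow> fst ` vert T A y = {x, y}"
  using compl_pair(1)[of A] unfolding vert_def by (auto simp: image_image image_constant_conv)

lemma vert_inj:
  assumes T: "T \<in> P'" "y \<in> T" "card A = 2" and T': "T' \<in> P'" "y' \<in> T'" "card A' = 2"
    and eq: "vert T A y = vert T' A' y'"
  shows "T = T' \<and> A = A' \<and> y = y'"
proof -
  note TD = P'_sub[OF T(1)] P'_sub[OF T'(1)]
  have yx: "y \<noteq> x" "y' \<noteq> x" using x_notin_D TD T T' by blast+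
  have "{x, y} = {x, y'}" using fst_vert T(3) T'(3) eq by metis
  then have y: "y = y'" using yx by auto
  have TT: "T = T'" using partition_on_ex1D[OF P'_part, of y] T T' D_sub[OF TD(1)] unfolding y by blast
  have "(x, i + \<Sum>A * \<mu> T y) \<in> vert T' A' y'" unfolding eq[symmetric] by (simp add: vert_def)
  then have "\<Sum>A * \<mu> T y = \<Sum>A' * \<mu> T y"
    using mem_vert_x[OF TD(2) T'(2)] unfolding TT y by simp
  then have S: "\<Sum>A = \<Sum>A'" using \<mu>_nonzero[OF TD(1) T(2)] by simp
  have "\<alpha> \<notin> A \<longleftrightarrow> \<alpha> \<notin> A'" for \<alpha>
  proof -
    define a where "a = i + \<alpha> * \<mu> T y + \<Sum>A * (\<mu> T y)\<^sup>2"
    then have "\<alpha> = slope T (\<Sum>A) y a"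
      unfolding gf4_solve[OF \<mu>_nonzero[OF TD(1) T(2)]] slope_def .
    then show ?thesis
      using mem_vert[OF TD(1) T(2) yx(1), of a A] mem_vert[OF TD(2) T'(2) yx(2), of a A'] eq S TT y by simp
  qed
  then show ?thesis using TT y by blast
qed

lemma fst_apex: "fst ` apex = {x}"
proof -
  obtain j where "j \<noteq> i" by (metis zero_neq_one)
  then show ?thesis unfolding apex_def by force
qed

lemma apex_notin_Some: "s \<in> I \<Longrightarrow> apex \<notin> slot_class (Some s)"
proof
  assume s: "s \<in> I" "apex \<in> slot_class (Some s)"
  from s(2) show False
  proof (cases rule: slot_class_Some_cases)
    case 1
    then have "c s = {x}" using fst_graph fst_apex by metis
    then show False using x_notin_D[OF c_D[OF s(1)]] by blast
  next
    case (2 y)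
    then have "{x, y} = {x}" using fst_vert[OF card_k[OF s(1)]] fst_apex by metis
    then show False using x_notin_D[OF c_D[OF s(1)]] 2(1) by blast
  next
    case (3 T \<alpha>)
    then have "T = {x}" using fst_graph fst_apex by metis
    then show False using x_notin_D R_D[OF s(1)] 3(1) by blast
  qed
qed

lemma graph_ne_vert: "T \<in> D \<Longrightarrow> card A = 2 \<Longrightarrow> graph T \<alpha> \<beta> \<noteq> vert T' A y"
  using fst_graph[of T \<alpha> \<beta>] fst_vert[of A T' y] x_notin_D[of T] by (metis insertI1)

lemma graph_in_None_iff:
  assumes "T \<in> D"
  shows "graph T \<alpha> \<beta> \<in> slot_class None \<longleftrightarrow> T \<in> P' \<and> \<beta> = 0"
proof
  assume "graph T \<alpha> \<beta> \<in> slot_class None"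
  then show "T \<in> P' \<and> \<beta> = 0"
  proof (cases rule: slot_class_None_cases)
    case 1
    then have "T = {x}" using fst_graph fst_apex by metis
    then show ?thesis using x_notin_D[OF assms] by blast
  next
    case 2
    then show ?thesis using graph_inj[OF assms 2(2)] by blast
  qed
qed (auto simp: slot_class_def)

lemma graph_in_Some_iff:
  assumes "T \<in> D" "s \<in> I"
  shows "graph T \<alpha> \<beta> \<in> slot_class (Some s) \<longleftrightarrow>
    T = c s \<and> \<beta> = \<Sum>(k s) \<and> \<alpha> \<in> k s \<or> T \<in> R s \<and> T \<noteq> c s \<and> \<beta> = h T s"
proof
  assume "graph T \<alpha> \<beta> \<in> slot_class (Some s)"
  then show "T = c s \<and> \<beta> = \<Sum>(k s) \<and> \<alpha> \<in> k s \<or> T \<in> R s \<and> T \<noteq> c s \<and> \<beta> = h T s"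
  proof (cases rule: slot_class_Some_cases)
    case 1
    then show ?thesis using graph_inj[OF assms(1) 1(2)] by blast
  next
    case 2
    then show ?thesis using graph_ne_vert[OF assms(1) card_k[OF assms(2)]] by blast
  next
    case 3
    then show ?thesis using graph_inj[OF assms(1) 3(3)] by blast
  qed
qed (auto simp: slot_class_def)

lemma vert_in_Some_iff:
  assumes "T \<in> P'" "y \<in> T" "card A = 2" "s \<in> I"
  shows "vert T A y \<in> slot_class (Some s) \<longleftrightarrow> c s = T \<and> k s = A"
proof
  assume "vert T A y \<in> slot_class (Some s)"
  then show "c s = T \<and> k s = A"
  proof (cases rule: slot_class_Some_cases)
    case 1
    then show ?thesis using graph_ne_vert[OF c_D[OF assms(4)] assms(3)] by metis
  next
    case (2 z)
    then show ?thesis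
      using vert_inj[OF assms(1-3) c_P'[OF assms(4)] 2(1) card_k[OF assms(4)] 2(2)] by blast
  next
    case (3 T')
    then have "T' \<in> D" using R_D[OF assms(4)] by blast
    then show ?thesis using graph_ne_vert[OF _ assms(3)] 3(3) by metis
  qed
qed (use assms in \<open>auto simp: slot_class_def\<close>)

lemma vert_notin_None:
  assumes "T \<in> P'" "y \<in> T" "card A = 2"
  shows "vert T A y \<notin> slot_class None"
proof
  assume "vert T A y \<in> slot_class None"
  then show False
  proof (cases rule: slot_class_None_cases)
    case 1
    then have "{x, y} = {x}" using fst_vert[OF assms(3)] fst_apex by metis
    then show ?thesis using x_notin_D[OF P'_sub[OF assms(1)]] assms(2) by blast
  next
    case (2 T')
    then show ?thesis using graph_ne_vert[OF P'_sub[OF 2(1)] assms(3)] by metis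
  qed
qed

lemma ex1_k:
  assumes "T \<in> P'" "card A = 2"
  shows "\<exists>!s. s \<in> I \<and> c s = T \<and> k s = A"
  using bij_betw_ex1[OF k_bij[OF assms(1)], of A] assms(2) by (simp add: conj_assoc)

lemma ex1_h:
  assumes "T \<in> D" "T \<notin> P'"
  shows "\<exists>!s. s \<in> I \<and> T \<in> R s \<and> h T s = \<beta>"
  using bij_betw_ex1[OF h_bij, of T \<beta>] assms by (simp add: conj_assoc)

lemma ex1_slot:
  assumes P: "\<And>s. s \<in> I \<Longrightarrow> B \<in> slot_class (Some s) \<longleftrightarrow> \<phi> s" and N: "B \<notin> slot_class None"
    and ex: "\<exists>!s. s \<in> I \<and> \<phi> s"
  shows "\<exists>!t. t \<in> insert None (Some ` I) \<and> B \<in> slot_class t"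
proof -
  obtain s where s: "s \<in> I \<and> \<phi> s" and u: "\<forall>s'. s' \<in> I \<and> \<phi> s' \<longrightarrow> s' = s"
    using ex by (rule ex1E)
  show ?thesis
  proof (rule ex1I[of _ "Some s"])
    show "Some s \<in> insert None (Some ` I) \<and> B \<in> slot_class (Some s)" using s P by blast
    show "t = Some s" if "t \<in> insert None (Some ` I) \<and> B \<in> slot_class t" for t
      using that N P u by blast
  qed
qed

lemma ex1_None:
  assumes "B \<in> slot_class None" "\<And>s. s \<in> I \<Longrightarrow> B \<notin> slot_class (Some s)"
  shows "\<exists>!t. t \<in> insert None (Some ` I) \<and> B \<in> slot_class t"
  by (rule ex1I[of _ None]) (use assms in blast)+

text \<open>It remains to locate each block in a unique class. A vertical triple determines a triple
  \<open>T \<in> P'\<close> and a set \<open>A\<close>, hence a slot through \<open>k\<close>; a graph over \<open>T \<notin> P'\<close> determines a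
  slot through \<open>h T\<close> and \<open>\<beta>\<close>; a graph over \<open>T \<in> P'\<close> belongs to \<open>None\<close> if \<open>\<beta> = 0\<close> and
  otherwise to the slot of the unique two-element set that contains \<open>\<alpha>\<close> and has sum \<open>\<beta>\<close>.\<close>
lemma star_resolvable: "resolvable points (insert apex (vpairs \<union> transversals))"
proof (rule resolvable_family[where S = "insert None (Some ` I)" and F = slot_class])
  have "apex \<noteq> {}" using fst_apex by auto
  moreover have "apex \<subseteq> points" unfolding apex_def points_def by auto
  ultimately show "points \<noteq> {}" by blast
next
  fix t assume "t \<in> insert None (Some ` I)"
  then consider "t = None" | s where "s \<in> I" "t = Some s" by blast
  then show "partition_on points (slot_class t) \<and> slot_class t \<subseteq> insert apex (vpairs \<union> transversals)"
  proof cases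
    case 1
    have "slot_class None \<subseteq> insert apex (vpairs \<union> transversals)"
      using graph_transversal P'_sub unfolding slot_class_def by auto
    then show ?thesis using 1 partition_None by simp
  next
    case 2
    note s = 2(1)
    have "B \<in> insert apex (vpairs \<union> transversals)" if "B \<in> slot_class (Some s)" for B
      using that
    proof (cases rule: slot_class_Some_cases)
      case 1 then show ?thesis using graph_transversal[OF c_D[OF s]] by simp
    next
      case 2 then show ?thesis using vert_vpair[OF c_P'[OF s] _ card_k[OF s]] by simp
    next
      case 3 then show ?thesis using graph_transversal R_D[OF s] by blast
    qed
    then show ?thesis using 2 partition_Some by blast
  qed
next
  fix B assume "B \<in> insert apex (vpairs \<union> transversals)"
  then consider "B = apex" | "B \<in> vpairs" | "B \<in> transversals" by blast
  then show "\<exists>!t. t \<in> insert None (Some ` I) \<and> B \<in> slot_class t"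
  proof cases
    case 1
    then show ?thesis using apex_notin_Some by (intro ex1_None) (auto simp: slot_class_def)
  next
    case 2
    then obtain T y A where B: "T \<in> P'" "y \<in> T" "card A = 2" "B = vert T A y" by (rule vpair_vert)
    show ?thesis unfolding B(4)
      by (rule ex1_slot[OF vert_in_Some_iff[OF B(1-3)] vert_notin_None[OF B(1-3)] ex1_k[OF B(1,3)]])
  next
    case 3
    then obtain T \<alpha> \<beta> where B: "T \<in> D" "B = graph T \<alpha> \<beta>" by (rule transversal_graph)
    show ?thesis
    proof (cases "T \<in> P'")
      case False
      then have eq: "graph T \<alpha> \<beta> \<in> slot_class (Some s) \<longleftrightarrow> T \<in> R s \<and> h T s = \<beta>" if "s \<in> I" for s
        using graph_in_Some_iff[OF B(1) that, of \<alpha> \<beta>] c_P'[OF that] by auto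
      have "graph T \<alpha> \<beta> \<notin> slot_class None" using graph_in_None_iff[OF B(1)] False by blast
      from ex1_slot[OF eq this ex1_h[OF B(1) False]] show ?thesis unfolding B(2) .
    next
      case True
      have eq: "graph T \<alpha> \<beta> \<in> slot_class (Some s) \<longleftrightarrow> c s = T \<and> k s = {\<alpha>, \<alpha> + \<beta>}" if "s \<in> I" for s
        using graph_in_Some_iff[OF B(1) that, of \<alpha> \<beta>] R_P'[OF that True]
          pair_gf4[OF card_k[OF that], of \<alpha> \<beta>] by blast
      show ?thesis
      proof (cases "\<beta> = 0")
        case True
        have "B \<notin> slot_class (Some s)" if "s \<in> I" for s
          using eq[OF that] card_k[OF that] True unfolding B(2) by auto
        then show ?thesis
          using graph_in_None_iff[OF B(1), of \<alpha> \<beta>] True \<open>T \<in> P'\<close> unfolding B(2) by (intro ex1_None) auto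
      next
        case False
        then have "graph T \<alpha> \<beta> \<notin> slot_class None" using graph_in_None_iff[OF B(1)] by blast
        from ex1_slot[OF eq this ex1_k[OF True card_pair[OF False]]] show ?thesis unfolding B(2) .
      qed
    qed
  qed
qed

end

section \<open>Labels from a weighted resolution\<close>

lemma count_classes:
  assumes fin: "\<And>k l. k \<in> K \<Longrightarrow> l \<in> L \<Longrightarrow> finite (P k l)" and KL: "finite K" "finite L"
  shows "count (\<Sum>k\<in>K. \<Sum>l\<in>L. mset_set (P k l)) T = card {kl \<in> K \<times> L. T \<in> P (fst kl) (snd kl)}"
proof -
  have "count (\<Sum>k\<in>K. \<Sum>l\<in>L. mset_set (P k l)) T = (\<Sum>k\<in>K. \<Sum>l\<in>L. count (mset_set (P k l)) T)"
    by (simp add: count_sum)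
  also have "\<dots> = (\<Sum>k\<in>K. \<Sum>l\<in>L. if T \<in> P k l then 1 else 0)"
    using fin by (intro sum.cong refl) (simp add: count_mset_set')
  also have "\<dots> = (\<Sum>kl\<in>K \<times> L. if T \<in> P (fst kl) (snd kl) then 1 else 0)"
    by (simp add: sum.cartesian_product case_prod_unfold)
  also have "\<dots> = card {kl \<in> K \<times> L. T \<in> P (fst kl) (snd kl)}"
    using KL by (simp add: sum.If_cases Int_def)
  finally show ?thesis .
qed

text \<open>Slots are triples of the two indices of a class and a bit for its two copies. The multiset
  identity says in how many slots a triple lies; for a triple of \<open>P'\<close> the three classes attached
  to it already account for all six, so that it lies in no other.\<close>
lemma star_labels:
  assumes star: "RDSQS_star v X \<B>" and x: "x \<in> X"
  obtains P' and I :: "((nat \<times> nat) \<times> bool) set" and c R \<mu> h k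
  where "labelled_star x (X - {x}) (derived_blocks \<B> x) P' I c R \<mu> h k"
proof -
  define D where "D = derived_blocks \<B> x"
  define K L where "K = {1..(v - 1) div 3}" and "L = {1..3::nat}"
  have S: "SQS v X \<B>" using star unfolding RDSQS_star_def by blast
  obtain P' b P where *: "parallel_class (X - {x}) D P' \<and> bij_betw b K P' \<and>
      (\<forall>k\<in>K. \<forall>l\<in>L. parallel_class (X - {x}) D (P k l)) \<and>
      (\<Sum>k\<in>K. \<Sum>l\<in>L. mset_set (P k l)) =
        repeat_mset 3 (mset_set P') + repeat_mset 2 (mset_set (D - P')) \<and>
      (\<forall>k\<in>K. \<forall>l\<in>L. b k \<in> P k l)"
    using star[unfolded RDSQS_star_def, THEN conjunct2, THEN conjunct2, THEN bspec, OF x,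
      folded D_def K_def L_def] by (elim exE) (rule that)
  from * have P': "parallel_class (X - {x}) D P'" by (elim conjE)
  from * have b: "bij_betw b K P'" by (elim conjE)
  from * have P: "\<forall>k\<in>K. \<forall>l\<in>L. parallel_class (X - {x}) D (P k l)" by (elim conjE)
  from * have mult: "(\<Sum>k\<in>K. \<Sum>l\<in>L. mset_set (P k l)) =
      repeat_mset 3 (mset_set P') + repeat_mset 2 (mset_set (D - P'))" by (elim conjE)
  from * have bP: "\<forall>k\<in>K. \<forall>l\<in>L. b k \<in> P k l" by (elim conjE)
  have D: "T \<subseteq> X - {x}" "card T = 3" "finite T" if "T \<in> D" for T
    using derived_triple[OF S _ x] that unfolding D_def by auto
  have "finite (Pow (X - {x}))" using S unfolding SQS_def by simp
  then have finD: "finite D" using D(1) by (elim finite_subset[rotated]) blast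
  have P'D: "P' \<subseteq> D" using P' unfolding parallel_class_def by blast
  have PD: "P k l \<subseteq> D" "partition_on (X - {x}) (P k l)" if "k \<in> K" "l \<in> L" for k l
    using P that unfolding parallel_class_def by blast+
  define I where "I = (K \<times> L) \<times> (UNIV :: bool set)"
  define R where "R = (\<lambda>s :: (nat \<times> nat) \<times> bool. P (fst (fst s)) (snd (fst s)))"
  define c where "c = (\<lambda>s :: (nat \<times> nat) \<times> bool. b (fst (fst s)))"
  have fin: "finite K" "finite L" "finite I" unfolding I_def K_def L_def by simp_all
  have card_R: "card {s \<in> I. T \<in> R s} = (if T \<in> P' then 6 else 4)" if "T \<in> D" for T
  proof -
    have "{s \<in> I. T \<in> R s} = {kl \<in> K \<times> L. T \<in> P (fst kl) (snd kl)} \<times> UNIV"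
      unfolding I_def R_def by auto
    then have "card {s \<in> I. T \<in> R s} = 2 * card {kl \<in> K \<times> L. T \<in> P (fst kl) (snd kl)}"
      by (simp add: card_cartesian_product)
    also have "card {kl \<in> K \<times> L. T \<in> P (fst kl) (snd kl)} = count (\<Sum>k\<in>K. \<Sum>l\<in>L. mset_set (P k l)) T"
      using PD(1) finD fin by (intro count_classes[symmetric]) (auto intro: finite_subset)
    also have "\<dots> = (if T \<in> P' then 3 else 2)"
      unfolding mult using that finD P'D by (simp add: count_mset_set' finite_subset)
    finally show ?thesis by simp
  qed
  have c_in: "c s \<in> P'" "c s \<in> R s" if "s \<in> I" for s
  proof -
    have s: "fst (fst s) \<in> K" "snd (fst s) \<in> L" using that unfolding I_def by auto
    show "c s \<in> P'" using bij_betw_apply[OF b s(1)] unfolding c_def .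
    show "c s \<in> R s" using bP s unfolding c_def R_def by blast
  qed
  have card_c: "card {s \<in> I. c s = T} = 6" if T: "T \<in> P'" for T
  proof -
    obtain k0 where k0: "k0 \<in> K \<and> b k0 = T" and u: "\<forall>k. k \<in> K \<and> b k = T \<longrightarrow> k = k0"
      using bij_betw_ex1[OF b T] by (rule ex1E)
    have "{s \<in> I. c s = T} = ({k \<in> K. b k = T} \<times> L) \<times> UNIV"
      unfolding I_def c_def by auto
    also have "{k \<in> K. b k = T} = {k0}" using k0 u by blast
    finally have "{s \<in> I. c s = T} = ({k0} \<times> L) \<times> UNIV" .
    then show ?thesis by (simp add: card_cartesian_product L_def)
  qed
  have c_eq: "{s \<in> I. c s = T} = {s \<in> I. T \<in> R s}" if "T \<in> P'" for T
  proof (rule card_subset_eq)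
    show "finite {s \<in> I. T \<in> R s}" using fin by simp
    show "{s \<in> I. c s = T} \<subseteq> {s \<in> I. T \<in> R s}" using c_in(2) by blast
    show "card {s \<in> I. c s = T} = card {s \<in> I. T \<in> R s}"
      using card_R card_c[OF that] that P'D by auto
  qed
  have "\<forall>T\<in>D. \<exists>\<mu>. bij_betw \<mu> T (- {0 :: gf4})"
    using D(2,3) by (intro ballI finite_same_card_bij) (auto simp: nonzero_gf4)
  then obtain \<mu> where \<mu>: "\<forall>T\<in>D. bij_betw (\<mu> T) T (- {0 :: gf4})" by (rule bchoice[THEN exE])
  have "\<forall>T\<in>D - P'. \<exists>h. bij_betw h {s \<in> I. T \<in> R s} (UNIV :: gf4 set)"
    using card_R fin by (intro ballI finite_same_card_bij) (auto simp: card_gf4)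
  then obtain h where h: "\<forall>T\<in>D - P'. bij_betw (h T) {s \<in> I. T \<in> R s} (UNIV :: gf4 set)"
    by (rule bchoice[THEN exE])
  have "\<forall>T\<in>P'. \<exists>k. bij_betw k {s \<in> I. c s = T} {A :: gf4 set. card A = 2}"
    using card_c fin by (intro ballI finite_same_card_bij) (auto simp: card_pairs_gf4)
  then obtain k where k: "\<forall>T\<in>P'. bij_betw (k T) {s \<in> I. c s = T} {A :: gf4 set. card A = 2}"
    by (rule bchoice[THEN exE])
  have k': "bij_betw (\<lambda>s. k (c s) s) {s \<in> I. c s = T} {A. card A = 2}" if "T \<in> P'" for T
    using bspec[OF k that] by (rule bij_betw_cong[THEN iffD1, rotated]) simp
  have "labelled_star x (X - {x}) D P' I c R \<mu> h (\<lambda>s. k (c s) s)"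
  proof
    show "x \<notin> X - {x}" by simp
    show "T \<subseteq> X - {x}" if "T \<in> D" for T using D(1)[OF that] .
    show "partition_on (X - {x}) P'" using P' unfolding parallel_class_def by blast
    show "P' \<subseteq> D" by (rule P'D)
    show "partition_on (X - {x}) (R s)" "R s \<subseteq> D" if "s \<in> I" for s
      using that PD[of "fst (fst s)" "snd (fst s)"] unfolding I_def R_def by auto
    show "c s \<in> P'" if "s \<in> I" for s using c_in(1)[OF that] .
    show "T \<in> R s \<longleftrightarrow> T = c s" if "s \<in> I" "T \<in> P'" for s T using c_eq[OF that(2)] that(1) by blast
    show "bij_betw (\<mu> T) T (- {0})" if "T \<in> D" for T using \<mu> that by blast
    show "bij_betw (h T) {s \<in> I. T \<in> R s} UNIV" if "T \<in> D - P'" for T using h that by blast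
    show "bij_betw (\<lambda>s. k (c s) s) {s \<in> I. c s = T} {A. card A = 2}" if "T \<in> P'" for T using k'[OF that] .
  qed
  then show ?thesis using that unfolding D_def by blast
qed

section \<open>Transport along injections\<close>

lemma partition_on_image_inj:
  assumes "partition_on A P" "inj_on f A"
  shows "partition_on (f ` A) ((`) f ` P)"
proof -
  have "{} \<notin> (`) f ` P" using partition_onD3[OF assms(1)] by auto
  then show ?thesis using partition_on_inj_image[OF assms] by simp
qed

lemma derived_image:
  assumes "inj_on f X" "\<And>B. B \<in> \<B> \<Longrightarrow> B \<subseteq> X" "x \<in> X"
  shows "derived_blocks ((`) f ` \<B>) (f x) = (`) f ` derived_blocks \<B> x"
proof -
  have 1: "f x \<in> f ` B \<longleftrightarrow> x \<in> B" if "B \<in> \<B>" for B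
    using assms that by (meson inj_on_image_mem_iff)
  have 2: "f ` (B - {x}) = f ` B - {f x}" if "B \<in> \<B>" for B
    using inj_on_image_set_diff[OF assms(1), of B "{x}"] assms(2)[OF that] assms(3) by auto
  have "derived_blocks \<B> x = (\<lambda>B. B - {x}) ` {B \<in> \<B>. x \<in> B}"
    unfolding derived_blocks_def by blast
  then have "(`) f ` derived_blocks \<B> x = (\<lambda>B. f ` (B - {x})) ` {B \<in> \<B>. x \<in> B}"
    by (simp only: image_image)
  also have "\<dots> = (\<lambda>B. f ` B - {f x}) ` {B \<in> \<B>. f x \<in> f ` B}"
    using 1 2 by (intro image_cong) auto
  also have "\<dots> = derived_blocks ((`) f ` \<B>) (f x)"
    unfolding derived_blocks_def by blast
  finally show ?thesis ..
qed

lemma resolvable_image: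
  assumes "resolvable Y \<C>" "inj_on f Y" "\<And>B. B \<in> \<C> \<Longrightarrow> B \<subseteq> Y"
  shows "resolvable (f ` Y) ((`) f ` \<C>)"
proof -
  obtain R where R: "partition_on \<C> R" "\<And>P. P \<in> R \<Longrightarrow> partition_on Y P \<and> P \<subseteq> \<C>"
    using assms(1) unfolding resolvable_def parallel_class_def by blast
  have "inj_on ((`) f) \<C>"
    using assms(2,3) by (intro inj_on_image inj_on_subset[OF assms(2)]) blast
  then have "partition_on ((`) f ` \<C>) ((`) ((`) f) ` R)" by (rule partition_on_image_inj[OF R(1)])
  moreover have "parallel_class (f ` Y) ((`) f ` \<C>) P" if "P \<in> (`) ((`) f) ` R" for P
    using that R(2) partition_on_image_inj[OF _ assms(2)] unfolding parallel_class_def by blast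
  ultimately show ?thesis unfolding resolvable_def by blast
qed

lemma SQS_image:
  assumes "SQS v X \<B>" "inj_on f X"
  shows "SQS v (f ` X) ((`) f ` \<B>)"
  unfolding SQS_def
proof (intro conjI ballI allI impI)
  show "finite (f ` X)" "card (f ` X) = v" using assms unfolding SQS_def by (auto simp: card_image)
  fix B assume "B \<in> (`) f ` \<B>"
  then show "B \<subseteq> f ` X" "card B = 4"
    using assms unfolding SQS_def by (auto simp: card_image inj_on_subset)
next
  fix T assume T: "T \<subseteq> f ` X \<and> card T = 3"
  then obtain S where S: "S \<subseteq> X" "T = f ` S" by (auto simp: subset_image_iff)
  then have "card S = 3" using T assms(2) by (metis card_image inj_on_subset)
  then obtain B where B: "B \<in> \<B>" "S \<subseteq> B" and u: "\<And>C. C \<in> \<B> \<Longrightarrow> S \<subseteq> C \<Longrightarrow> C = B"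
    using assms(1) S unfolding SQS_def by metis
  have X: "C \<subseteq> X" if "C \<in> \<B>" for C using assms(1) that unfolding SQS_def by blast
  show "\<exists>!B. B \<in> (`) f ` \<B> \<and> T \<subseteq> B"
  proof (rule ex1I[of _ "f ` B"])
    show "f ` B \<in> (`) f ` \<B> \<and> T \<subseteq> f ` B" using B S by auto
    fix C assume "C \<in> (`) f ` \<B> \<and> T \<subseteq> C"
    then obtain C' where C': "C = f ` C'" "C' \<in> \<B>" "f ` S \<subseteq> f ` C'" using S by auto
    have "S \<subseteq> C'"
    proof
      fix z assume "z \<in> S"
      then show "z \<in> C'" using inj_on_image_mem_iff[OF assms(2), of z C'] X[OF C'(2)] C'(3) S(1) by blast
    qed
    then show "C = f ` B" using u C' by auto
  qed
qed

lemma RDSQS_image: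
  assumes "RDSQS v X \<B>" "inj_on f X"
  shows "RDSQS v (f ` X) ((`) f ` \<B>)"
  unfolding RDSQS_def
proof (intro conjI ballI)
  have S: "SQS v X \<B>" using assms(1) unfolding RDSQS_def by blast
  then show "SQS v (f ` X) ((`) f ` \<B>)" using assms(2) by (rule SQS_image)
  have X: "C \<subseteq> X" if "C \<in> \<B>" for C using S that unfolding SQS_def by blast
  fix y assume "y \<in> f ` X"
  then obtain x where x: "x \<in> X" "y = f x" by blast
  have "resolvable (X - {x}) (derived_blocks \<B> x)"
    using assms(1) x(1) unfolding RDSQS_def by blast
  then have "resolvable (f ` (X - {x})) ((`) f ` derived_blocks \<B> x)"
    using inj_on_subset[OF assms(2) Diff_subset] derived_triple(1)[OF S _ x(1)]
    by (rule resolvable_image)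
  moreover have "f ` (X - {x}) = f ` X - {y}"
    using inj_on_image_set_diff[OF assms(2), of X "{x}"] x by auto
  moreover have "(`) f ` derived_blocks \<B> x = derived_blocks ((`) f ` \<B>) y"
    unfolding x(2) by (rule derived_image[symmetric]) (fact assms(2) X x(1))+
  ultimately show "resolvable (f ` X - {y}) (derived_blocks ((`) f ` \<B>) y)"
    by (simp only:)
qed

section \<open>Quadrupling\<close>

lemma RDSQS_prod:
  assumes star: "RDSQS_star v X \<B>"
  shows "RDSQS (4 * v) (X \<times> UNIV) (quads (prod_rel (block_rel X \<B>)))"
  unfolding RDSQS_def
proof (intro conjI ballI)
  have S: "SQS v X \<B>" using star unfolding RDSQS_star_def by blast
  then have X: "finite X" "card X = v" unfolding SQS_def by simp_all
  show "SQS (4 * v) (X \<times> UNIV) (quads (prod_rel (block_rel X \<B>)))"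
    using skein_SQS[OF _ skein_prod[OF SQS_skein[OF S]]] X
    by (simp add: card_cartesian_product card_gf4 mult.commute)
  fix p assume "p \<in> X \<times> (UNIV :: gf4 set)"
  then obtain x i where p: "p = (x, i)" and x: "x \<in> X" by blast
  obtain P' and I :: "((nat \<times> nat) \<times> bool) set" and c R \<mu> h k
    where "labelled_star x (X - {x}) (derived_blocks \<B> x) P' I c R \<mu> h k"
    using star_labels[OF star x] by blast
  then interpret labelled_star x "X - {x}" "derived_blocks \<B> x" P' I c R \<mu> h k i .
  have "points = X \<times> UNIV - {p}" unfolding points_def p using x by auto
  moreover have "insert apex (vpairs \<union> transversals) =
      derived_blocks (quads (prod_rel (block_rel X \<B>))) p"
    unfolding p derived_prod[OF S x] apex_def vpairs_def transversals_def ..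
  ultimately show "resolvable (X \<times> UNIV - {p}) (derived_blocks (quads (prod_rel (block_rel X \<B>))) p)"
    using star_resolvable by simp
qed

theorem mainTheorem2:
  fixes v :: nat
  assumes "\<exists>(X :: 'a set) \<B>. RDSQS_star v X \<B>"
  shows "\<exists>(Y :: nat set) \<C>. RDSQS (4 * v) Y \<C>"
proof -
  obtain X :: "'a set" and \<B> where star: "RDSQS_star v X \<B>" using assms by blast
  have "finite X" using star unfolding RDSQS_star_def SQS_def by blast
  then have "finite (X \<times> (UNIV :: gf4 set))" by simp
  then obtain f :: "'a \<times> gf4 \<Rightarrow> nat" where "inj_on f (X \<times> UNIV)"
    using finite_imp_inj_to_nat_seg by metis
  with RDSQS_prod[OF star] show ?thesis using RDSQS_image by blast
qed

end
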